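(* Let $(M,g_0)$ be a Riemann surface with conformal metric written in a local conformal coordinate $z$ as $g_0=h\,dz\,d\bar z$, $h=2g_0(\partial_z,\partial_{\bar z})>0$, with Kähler form $\omega=\frac{ih}{2}dz\wedge d\bar z$ and Levi-Civita connection $\nabla$. Let $\mathcal Z^\omega$ be the symplectic twistor space of $M$, with almost complex structure $\mathcal J^\nabla$ and local chart $(z,w)$, $|w|<1$. A (complex-valued, locally defined) function $f\in C^\infty_{\mathcal Z^\omega}$ is $\mathcal J^\nabla$-holomorphic if and only if $$\frac{\partial f}{\partial\bar w}=0,\qquad h\frac{\partial f}{\partial\bar z}+hw\frac{\partial f}{\partial z}+w\Bigl(\frac{\partial h}{\partial\bar z}-w\frac{\partial h}{\partial z}\Bigr)\frac{\partial f}{\partial w}=0.$$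
   Context: $\pi:\mathcal Z^\omega\to M$ is the bundle whose fibre over $x$ is the set of linear complex structures $j$ on $T_xM$ with $\omega(j\cdot,j\cdot)=\omega$ and $\omega(\cdot,j\cdot)$ positive definite. The chart $(z,w)$ on $\mathcal Z^\omega$ is defined as follows: the point $j$ over the point with coordinate $z$ has fibre coordinate $w\in\mathbb C$, $|w|<1$, where the $+i$-eigenline of $j$ in $TM\otimes\mathbb C$ is spanned by $\partial_z+\bar w\,\partial_{\bar z}$. The almost complex structure $\mathcal J^\nabla$ is defined as follows. The vertical space $\mathcal V_j=\ker d\pi_j$ consists of endomorphisms $A\in\mathfrak{sp}(T_xM,\omega)$ with $Aj=-jA$. Let $\Phi$ be the canonical section of $\mathrm{End}(\pi^*TM)$, $\Phi_j=j$; $\pi^*\nabla_\cdot\Phi$ is a projection onto $\mathcal V$ with kernel $\mathcal H^\nabla$, so $T\mathcal Z^\omega=\mathcal H^\nabla\oplus\mathcal V$ and $d\pi:\mathcal H^\nabla_j\to T_{\pi(j)}M$ is an isomorphism. $\mathcal J^\nabla$ preserves the splitting, is $A\mapsto jA$ on $\mathcal V_j$, and on $\mathcal H^\nabla_j$ is, via $d\pi$, the endomorphism $j$ itself. A function $f$ is $\mathcal J^\nabla$-holomorphic if $df\circ\mathcal J^\nabla=i\,df$. *)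

theory Defs
  imports "HOL-Analysis.Analysis"
begin

section \<open>Smooth functions and Wirtinger derivatives\<close>

primrec Ck_on :: "nat \<Rightarrow> 'a::euclidean_space set \<Rightarrow> ('a \<Rightarrow> 'b::real_normed_vector) \<Rightarrow> bool" where
  "Ck_on 0 S f \<longleftrightarrow> continuous_on S f"
| "Ck_on (Suc k) S f \<longleftrightarrow> (\<forall>x\<in>S. f differentiable (at x)) \<and>
     (\<forall>v. Ck_on k S (\<lambda>x. frechet_derivative f (at x) v))"

text \<open>Only used for open \<open>S\<close>.\<close>

definition Cinf_on :: "'a::euclidean_space set \<Rightarrow> ('a \<Rightarrow> 'b::real_normed_vector) \<Rightarrow> bool" where
  "Cinf_on S f \<longleftrightarrow> (\<forall>k. Ck_on k S f)"

definition wirtinger :: "(complex \<Rightarrow> complex) \<Rightarrow> complex \<Rightarrow> complex" where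
  "wirtinger F z = (frechet_derivative F (at z) 1 - \<i> * frechet_derivative F (at z) \<i>) / 2"

definition wirtinger_bar :: "(complex \<Rightarrow> complex) \<Rightarrow> complex \<Rightarrow> complex" where
  "wirtinger_bar F z = (frechet_derivative F (at z) 1 + \<i> * frechet_derivative F (at z) \<i>) / 2"


section \<open>Riemann surfaces\<close>

text \<open>The underlying space of the surface is a Hausdorff type \<open>'a\<close>. A chart is a pair of an open
  domain and a coordinate function, of which only the values on the domain matter. Neither
  connectedness nor second countability is required.\<close>

type_synonym 'a chart = "'a set \<times> ('a \<Rightarrow> complex)"

abbreviation cdom :: "'a chart \<Rightarrow> 'a set" where
  "cdom c \<equiv> fst c"

abbreviation coord :: "'a chart \<Rightarrow> 'a \<Rightarrow> complex" where
  "coord c \<equiv> snd c"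

definition cimg :: "'a chart \<Rightarrow> complex set" where
  "cimg c = coord c ` cdom c"

definition cinv :: "'a chart \<Rightarrow> complex \<Rightarrow> 'a" where
  "cinv c = inv_into (cdom c) (coord c)"

definition transition :: "'a chart \<Rightarrow> 'a chart \<Rightarrow> complex \<Rightarrow> complex" where
  "transition c d = coord d \<circ> cinv c"

definition riemann_surface :: "'a::t2_space chart set \<Rightarrow> bool" where
  "riemann_surface A \<longleftrightarrow>
     (\<Union>c\<in>A. cdom c) = UNIV \<and>
     (\<forall>c\<in>A. open (cdom c) \<and> open (cimg c) \<and>
        homeomorphism (cdom c) (cimg c) (coord c) (cinv c)) \<and>
     (\<forall>c\<in>A. \<forall>d\<in>A. transition c d holomorphic_on (coord c ` (cdom c \<inter> cdom d)))"

definition charts_at :: "'a chart set \<Rightarrow> 'a \<Rightarrow> 'a chart set" where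
  "charts_at A x = {c \<in> A. x \<in> cdom c}"


section \<open>Tangent vectors\<close>

text \<open>A tangent vector at \<open>x\<close> is the family of its components in all charts around \<open>x\<close>, transforming
  by the derivatives of the transition maps; it is set to 0 on all other charts. The component
  \<open>a + \<i> b\<close> in the chart \<open>x + \<i> y\<close> stands for the real vector \<open>a \<partial>\<^sub>x + b \<partial>\<^sub>y\<close>. Vector space operations
  on such families are pointwise.\<close>

type_synonym 'a tvec = "'a chart \<Rightarrow> complex"

abbreviation fam_add :: "('c \<Rightarrow> 'v::real_vector) \<Rightarrow> ('c \<Rightarrow> 'v) \<Rightarrow> 'c \<Rightarrow> 'v" (infixl "+\<^sub>t" 65) where
  "u +\<^sub>t v \<equiv> (\<lambda>c. u c + v c)"

abbreviation fam_diff :: "('c \<Rightarrow> 'v::real_vector) \<Rightarrow> ('c \<Rightarrow> 'v) \<Rightarrow> 'c \<Rightarrow> 'v" (infixl "-\<^sub>t" 65) where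
  "u -\<^sub>t v \<equiv> (\<lambda>c. u c - v c)"

abbreviation fam_scale :: "real \<Rightarrow> ('c \<Rightarrow> 'v::real_vector) \<Rightarrow> 'c \<Rightarrow> 'v" (infixr "*\<^sub>t" 75) where
  "r *\<^sub>t u \<equiv> (\<lambda>c. r *\<^sub>R u c)"

abbreviation fam_zero :: "'c \<Rightarrow> 'v::real_vector" ("0\<^sub>t") where
  "0\<^sub>t \<equiv> (\<lambda>_. 0)"

definition fam_linear_on ::
  "('c \<Rightarrow> 'v::real_vector) set \<Rightarrow> (('c \<Rightarrow> 'v) \<Rightarrow> ('d \<Rightarrow> 'w::real_vector)) \<Rightarrow> bool" where
  "fam_linear_on T F \<longleftrightarrow>
     (\<forall>u\<in>T. \<forall>v\<in>T. F (u +\<^sub>t v) = F u +\<^sub>t F v) \<and> (\<forall>r. \<forall>u\<in>T. F (r *\<^sub>t u) = r *\<^sub>t F u)"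

definition tangent_space :: "'a chart set \<Rightarrow> 'a \<Rightarrow> 'a tvec set" where
  "tangent_space A x =
     {v. (\<forall>c. c \<notin> charts_at A x \<longrightarrow> v c = 0) \<and>
         (\<forall>c\<in>charts_at A x. \<forall>d\<in>charts_at A x. v d = deriv (transition c d) (coord c x) * v c)}"

text \<open>The tangent vector at \<open>x\<close> with component \<open>a\<close> in the chart \<open>c\<close>.\<close>

definition coord_vec :: "'a chart set \<Rightarrow> 'a chart \<Rightarrow> complex \<Rightarrow> 'a \<Rightarrow> 'a tvec" where
  "coord_vec A c a x =
     (\<lambda>d. if d \<in> charts_at A x then deriv (transition c d) (coord c x) * a else 0)"

text \<open>The complex structure of the surface.\<close>

definition rot :: "'a tvec \<Rightarrow> 'a tvec" where
  "rot v = (\<lambda>c. \<i> * v c)"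

text \<open>The complexified tangent space: \<open>(u, v)\<close> stands for \<open>u + \<i> v\<close>, where \<open>\<i>\<close> is the scalar, not
  the complex structure of the surface. Hence \<open>\<partial>\<^sub>z = (\<partial>\<^sub>x - \<i> \<partial>\<^sub>y) / 2\<close> is the pair
  \<open>(\<partial>\<^sub>x / 2, - \<partial>\<^sub>y / 2)\<close>.\<close>

type_synonym 'a ctvec = "'a tvec \<times> 'a tvec"

definition ct_add :: "'a ctvec \<Rightarrow> 'a ctvec \<Rightarrow> 'a ctvec" where
  "ct_add s t = (fst s +\<^sub>t fst t, snd s +\<^sub>t snd t)"

definition ct_scale :: "complex \<Rightarrow> 'a ctvec \<Rightarrow> 'a ctvec" where
  "ct_scale a s = (Re a *\<^sub>t fst s -\<^sub>t Im a *\<^sub>t snd s, Re a *\<^sub>t snd s +\<^sub>t Im a *\<^sub>t fst s)"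

definition partial_z :: "'a chart set \<Rightarrow> 'a chart \<Rightarrow> 'a \<Rightarrow> 'a ctvec" where
  "partial_z A c x = (coord_vec A c (1/2) x, coord_vec A c (- \<i>/2) x)"

definition partial_zbar :: "'a chart set \<Rightarrow> 'a chart \<Rightarrow> 'a \<Rightarrow> 'a ctvec" where
  "partial_zbar A c x = (coord_vec A c (1/2) x, coord_vec A c (\<i>/2) x)"


section \<open>Conformal metrics\<close>

definition conformal_metric ::
  "'a::t2_space chart set \<Rightarrow> ('a \<Rightarrow> 'a tvec \<Rightarrow> 'a tvec \<Rightarrow> real) \<Rightarrow> bool" where
  "conformal_metric A g \<longleftrightarrow>
     (\<forall>x. let T = tangent_space A x in
        (\<forall>u\<in>T. \<forall>v\<in>T. g x u v = g x v u) \<and>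
        (\<forall>u\<in>T. \<forall>v\<in>T. \<forall>w\<in>T. g x (u +\<^sub>t v) w = g x u w + g x v w) \<and>
        (\<forall>r. \<forall>u\<in>T. \<forall>w\<in>T. g x (r *\<^sub>t u) w = r * g x u w) \<and>
        (\<forall>u\<in>T. u \<noteq> 0\<^sub>t \<longrightarrow> g x u u > 0) \<and>
        (\<forall>u\<in>T. \<forall>v\<in>T. g x (rot u) (rot v) = g x u v)) \<and>
     (\<forall>c\<in>A. \<forall>a b. Cinf_on (cimg c)
        (\<lambda>z. g (cinv c z) (coord_vec A c a (cinv c z)) (coord_vec A c b (cinv c z))))"

text \<open>The complex bilinear extension of the metric.\<close>

definition metric_C :: "('a \<Rightarrow> 'a tvec \<Rightarrow> 'a tvec \<Rightarrow> real) \<Rightarrow> 'a \<Rightarrow> 'a ctvec \<Rightarrow> 'a ctvec \<Rightarrow> complex" where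
  "metric_C g x s t =
     Complex (g x (fst s) (fst t) - g x (snd s) (snd t)) (g x (fst s) (snd t) + g x (snd s) (fst t))"

text \<open>The factor \<open>h\<close> with \<open>g(u, v) = h Re (u cnj v)\<close> in the chart. Twice the metric product of
  \<open>partial_z\<close> and \<open>partial_zbar\<close> is a real number, so taking the real part only adjusts the type.\<close>

definition conformal_factor ::
  "'a chart set \<Rightarrow> ('a \<Rightarrow> 'a tvec \<Rightarrow> 'a tvec \<Rightarrow> real) \<Rightarrow> 'a chart \<Rightarrow> complex \<Rightarrow> real" where
  "conformal_factor A g c z =
     Re (2 * metric_C g (cinv c z) (partial_z A c (cinv c z)) (partial_zbar A c (cinv c z)))"

text \<open>In a chart with conformal factor \<open>h\<close> this is \<open>h dx \<and> dy\<close>, which is \<open>\<i> h / 2\<close> times the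
  wedge product of \<open>dz\<close> and its conjugate.\<close>

definition kaehler_form ::
  "('a \<Rightarrow> 'a tvec \<Rightarrow> 'a tvec \<Rightarrow> real) \<Rightarrow> 'a \<Rightarrow> 'a tvec \<Rightarrow> 'a tvec \<Rightarrow> real" where
  "kaehler_form g x u v = g x (rot u) v"


section \<open>The Levi-Civita connection\<close>

definition smooth_fun :: "'a::t2_space chart set \<Rightarrow> 'a set \<Rightarrow> ('a \<Rightarrow> real) \<Rightarrow> bool" where
  "smooth_fun A U \<phi> \<longleftrightarrow> (\<forall>c\<in>A. Cinf_on (coord c ` (U \<inter> cdom c)) (\<phi> \<circ> cinv c))"

definition smooth_vf :: "'a::t2_space chart set \<Rightarrow> 'a set \<Rightarrow> ('a \<Rightarrow> 'a tvec) \<Rightarrow> bool" where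
  "smooth_vf A U Y \<longleftrightarrow>
     (\<forall>x\<in>U. Y x \<in> tangent_space A x) \<and>
     (\<forall>c\<in>A. Cinf_on (coord c ` (U \<inter> cdom c)) (\<lambda>z. Y (cinv c z) c))"

text \<open>The derivative of \<open>\<phi>\<close> along the tangent vector \<open>v\<close> at \<open>x\<close>, computed in the chart \<open>c\<close> around
  \<open>x\<close> (and independent of it).\<close>

definition dir_deriv :: "'a chart \<Rightarrow> ('a \<Rightarrow> real) \<Rightarrow> 'a \<Rightarrow> 'a tvec \<Rightarrow> real" where
  "dir_deriv c \<phi> x v = frechet_derivative (\<phi> \<circ> cinv c) (at (coord c x)) (v c)"

definition lie_bracket ::
  "'a chart set \<Rightarrow> ('a \<Rightarrow> 'a tvec) \<Rightarrow> ('a \<Rightarrow> 'a tvec) \<Rightarrow> 'a \<Rightarrow> 'a tvec" where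
  "lie_bracket A X Y x =
     (\<lambda>c. if c \<in> charts_at A x
          then frechet_derivative (\<lambda>z. Y (cinv c z) c) (at (coord c x)) (X x c)
             - frechet_derivative (\<lambda>z. X (cinv c z) c) (at (coord c x)) (Y x c)
          else 0)"

text \<open>\<open>nabla x v Y\<close> is the covariant derivative at \<open>x\<close>, in the direction \<open>v\<close>, of a vector field \<open>Y\<close>
  that is smooth on some open set around \<open>x\<close>.\<close>

type_synonym 'a connection = "'a \<Rightarrow> 'a tvec \<Rightarrow> ('a \<Rightarrow> 'a tvec) \<Rightarrow> 'a tvec"

definition affine_connection :: "'a::t2_space chart set \<Rightarrow> 'a connection \<Rightarrow> bool" where
  "affine_connection A nabla \<longleftrightarrow>
     (\<forall>U Y. open U \<and> smooth_vf A U Y \<longrightarrow>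
        (\<forall>x\<in>U. (\<forall>v\<in>tangent_space A x. nabla x v Y \<in> tangent_space A x) \<and>
           fam_linear_on (tangent_space A x) (\<lambda>v. nabla x v Y)) \<and>
        (\<forall>Y'. smooth_vf A U Y' \<longrightarrow> (\<forall>x\<in>U. \<forall>v\<in>tangent_space A x.
           nabla x v (\<lambda>y. Y y +\<^sub>t Y' y) = nabla x v Y +\<^sub>t nabla x v Y')) \<and>
        (\<forall>\<phi>. smooth_fun A U \<phi> \<longrightarrow> (\<forall>x\<in>U. \<forall>v\<in>tangent_space A x. \<forall>c\<in>charts_at A x.
           nabla x v (\<lambda>y. \<phi> y *\<^sub>t Y y) = dir_deriv c \<phi> x v *\<^sub>t Y x +\<^sub>t \<phi> x *\<^sub>t nabla x v Y)) \<and>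
        (\<forall>Y'. (\<forall>y\<in>U. Y' y = Y y) \<longrightarrow>
           (\<forall>x\<in>U. \<forall>v\<in>tangent_space A x. nabla x v Y' = nabla x v Y)) \<and>
        (\<forall>X. smooth_vf A U X \<longrightarrow> smooth_vf A U (\<lambda>x. nabla x (X x) Y)))"

definition levi_civita ::
  "'a::t2_space chart set \<Rightarrow> ('a \<Rightarrow> 'a tvec \<Rightarrow> 'a tvec \<Rightarrow> real) \<Rightarrow> 'a connection \<Rightarrow> bool" where
  "levi_civita A g nabla \<longleftrightarrow>
     affine_connection A nabla \<and>
     (\<forall>U X Y. open U \<and> smooth_vf A U X \<and> smooth_vf A U Y \<longrightarrow>
        (\<forall>x\<in>U. nabla x (X x) Y -\<^sub>t nabla x (Y x) X = lie_bracket A X Y x) \<and>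
        (\<forall>x\<in>U. \<forall>v\<in>tangent_space A x. \<forall>c\<in>charts_at A x.
           dir_deriv c (\<lambda>y. g y (X y) (Y y)) x v = g x (nabla x v X) (Y x) + g x (X x) (nabla x v Y)))"


section \<open>The symplectic twistor space\<close>

text \<open>Points of the twistor space are pairs \<open>(x, j)\<close>; the endomorphism \<open>j\<close> of the tangent space at
  \<open>x\<close> is made extensional so that it is determined by its values there.\<close>

type_synonym 'a tpoint = "'a \<times> ('a tvec \<Rightarrow> 'a tvec)"

definition twistor_space ::
  "'a chart set \<Rightarrow> ('a \<Rightarrow> 'a tvec \<Rightarrow> 'a tvec \<Rightarrow> real) \<Rightarrow> 'a tpoint set" where
  "twistor_space A \<omega> =
     {(x, j). let T = tangent_space A x in
        j \<in> T \<rightarrow>\<^sub>E T \<and> fam_linear_on T j \<and>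
        (\<forall>u\<in>T. j (j u) = (-1) *\<^sub>t u) \<and>
        (\<forall>u\<in>T. \<forall>v\<in>T. \<omega> x (j u) (j v) = \<omega> x u v) \<and>
        (\<forall>u\<in>T. u \<noteq> 0\<^sub>t \<longrightarrow> \<omega> x u (j u) > 0)}"

text \<open>The eigenspace of the complex linear extension of \<open>j\<close> for the eigenvalue \<open>\<i>\<close>.\<close>

definition eigenline :: "'a chart set \<Rightarrow> 'a tpoint \<Rightarrow> 'a ctvec set" where
  "eigenline A p =
     {s \<in> tangent_space A (fst p) \<times> tangent_space A (fst p).
        (snd p (fst s), snd p (snd s)) = ct_scale \<i> s}"

text \<open>The point over the point with coordinate \<open>z\<close> in the chart \<open>c\<close> and with fibre coordinate \<open>w\<close>,
  for \<open>z \<in> cimg c\<close> and \<open>norm w < 1\<close>; that is, the inverse of the chart \<open>(z, w)\<close>.\<close>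

definition twistor_point ::
  "'a chart set \<Rightarrow> ('a \<Rightarrow> 'a tvec \<Rightarrow> 'a tvec \<Rightarrow> real) \<Rightarrow> 'a chart \<Rightarrow> complex \<Rightarrow> complex \<Rightarrow> 'a tpoint" where
  "twistor_point A \<omega> c z w =
     (THE p. p \<in> twistor_space A \<omega> \<and> fst p = cinv c z \<and>
        eigenline A p =
          range (\<lambda>a. ct_scale a
            (ct_add (partial_z A c (fst p)) (ct_scale (cnj w) (partial_zbar A c (fst p))))))"

text \<open>The topology and the smooth structure of the twistor space are those given by the charts
  \<open>(z, w)\<close> arising from all charts of the surface.\<close>

definition twistor_open ::
  "'a chart set \<Rightarrow> ('a \<Rightarrow> 'a tvec \<Rightarrow> 'a tvec \<Rightarrow> real) \<Rightarrow> 'a tpoint set \<Rightarrow> bool" where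
  "twistor_open A \<omega> W \<longleftrightarrow>
     W \<subseteq> twistor_space A \<omega> \<and>
     (\<forall>c\<in>A. open {(z, w). z \<in> cimg c \<and> norm w < 1 \<and> twistor_point A \<omega> c z w \<in> W})"

definition twistor_smooth ::
  "'a chart set \<Rightarrow> ('a \<Rightarrow> 'a tvec \<Rightarrow> 'a tvec \<Rightarrow> real) \<Rightarrow> 'a tpoint set \<Rightarrow> ('a tpoint \<Rightarrow> complex) \<Rightarrow> bool" where
  "twistor_smooth A \<omega> W f \<longleftrightarrow>
     (\<forall>c\<in>A. Cinf_on {(z, w). z \<in> cimg c \<and> norm w < 1 \<and> twistor_point A \<omega> c z w \<in> W}
        (\<lambda>(z, w). f (twistor_point A \<omega> c z w)))"


section \<open>Tangent vectors of the twistor space\<close>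

text \<open>The coordinates of a point of the twistor space in the total space of \<open>End(TM)\<close>, trivialised
  by the chart \<open>c\<close>.\<close>

definition tw_rep :: "'a chart set \<Rightarrow> 'a chart \<Rightarrow> 'a tpoint \<Rightarrow> complex \<times> (complex \<Rightarrow>\<^sub>L complex)" where
  "tw_rep A c p = (coord c (fst p), Blinfun (\<lambda>a. snd p (coord_vec A c a (fst p)) c))"

text \<open>Tangent vectors of the twistor space are velocities of curves in it, again given by their
  components in all charts.\<close>

type_synonym 'a ttvec = "'a chart \<Rightarrow> complex \<times> (complex \<Rightarrow>\<^sub>L complex)"

definition has_velocity ::
  "'a::t2_space chart set \<Rightarrow> 'a tpoint set \<Rightarrow> (real \<Rightarrow> 'a tpoint) \<Rightarrow> 'a tpoint \<Rightarrow> 'a ttvec \<Rightarrow> bool" where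
  "has_velocity A Z \<gamma> p \<xi> \<longleftrightarrow>
     \<gamma> 0 = p \<and> (\<forall>t. \<gamma> t \<in> Z) \<and> isCont (fst \<circ> \<gamma>) 0 \<and>
     (\<forall>c\<in>charts_at A (fst p). ((tw_rep A c \<circ> \<gamma>) has_vector_derivative \<xi> c) (at 0)) \<and>
     (\<forall>c. c \<notin> charts_at A (fst p) \<longrightarrow> \<xi> c = 0)"

definition tw_tangent :: "'a::t2_space chart set \<Rightarrow> 'a tpoint set \<Rightarrow> 'a tpoint \<Rightarrow> 'a ttvec set" where
  "tw_tangent A Z p = {\<xi>. \<exists>\<gamma>. has_velocity A Z \<gamma> p \<xi>}"

definition tw_differential ::
  "'a::t2_space chart set \<Rightarrow> 'a tpoint set \<Rightarrow> ('a tpoint \<Rightarrow> complex) \<Rightarrow> 'a tpoint \<Rightarrow> 'a ttvec \<Rightarrow> complex" where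
  "tw_differential A Z f p \<xi> =
     (THE D. \<exists>\<gamma>. has_velocity A Z \<gamma> p \<xi> \<and> ((f \<circ> \<gamma>) has_vector_derivative D) (at 0))"

definition d_pi :: "'a ttvec \<Rightarrow> 'a tvec" where
  "d_pi \<xi> = (\<lambda>c. fst (\<xi> c))"

definition vertical :: "'a::t2_space chart set \<Rightarrow> 'a tpoint set \<Rightarrow> 'a tpoint \<Rightarrow> 'a ttvec set" where
  "vertical A Z p = {\<xi> \<in> tw_tangent A Z p. d_pi \<xi> = 0\<^sub>t}"

text \<open>The endomorphism of the tangent space of the surface that a vertical vector is.\<close>

definition vert_endo :: "'a ttvec \<Rightarrow> 'a tvec \<Rightarrow> 'a tvec" where
  "vert_endo \<xi> u = (\<lambda>c. blinfun_apply (snd (\<xi> c)) (u c))"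

text \<open>The derivative of the canonical section \<open>\<Phi>\<close> of \<open>End(\<pi>\<^sup>*TM)\<close> along \<open>\<xi>\<close> for the pulled back
  connection, applied to \<open>u\<close>. In the chart \<open>c\<close>, let \<open>U\<close> be the extension of \<open>u\<close> to a vector field
  with constant components, and evaluate \<open>\<nabla>(\<Phi> U) - \<Phi>(\<nabla> U)\<close>. The components of \<open>\<Phi> U\<close> at \<open>(x, j)\<close> are
  those of \<open>j\<close> applied to \<open>u\<close>. Their derivative along \<open>\<xi>\<close> is the first summand, and the second
  summand is the contribution of the Christoffel symbols.\<close>

definition nabla_Phi ::
  "'a chart set \<Rightarrow> 'a connection \<Rightarrow> 'a tpoint \<Rightarrow> 'a ttvec \<Rightarrow> 'a tvec \<Rightarrow> 'a tvec" where
  "nabla_Phi A nabla p \<xi> u =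
     (\<lambda>c. if c \<in> charts_at A (fst p)
          then blinfun_apply (snd (\<xi> c)) (u c)
             + nabla (fst p) (d_pi \<xi>) (coord_vec A c (snd p u c)) c
             - snd p (nabla (fst p) (d_pi \<xi>) (coord_vec A c (u c))) c
          else 0)"

definition horizontal ::
  "'a::t2_space chart set \<Rightarrow> 'a connection \<Rightarrow> 'a tpoint set \<Rightarrow> 'a tpoint \<Rightarrow> 'a ttvec set" where
  "horizontal A nabla Z p =
     {\<xi> \<in> tw_tangent A Z p. \<forall>u\<in>tangent_space A (fst p). nabla_Phi A nabla p \<xi> u = 0\<^sub>t}"

text \<open>\<open>J\<close> is the almost complex structure at the point \<open>p = (x, j)\<close>; this determines it on the
  tangent space at \<open>p\<close>.\<close>

definition is_J_nabla ::
  "'a::t2_space chart set \<Rightarrow> 'a connection \<Rightarrow> 'a tpoint set \<Rightarrow> 'a tpoint \<Rightarrow> ('a ttvec \<Rightarrow> 'a ttvec) \<Rightarrow> bool" where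
  "is_J_nabla A nabla Z p J \<longleftrightarrow>
     J ` tw_tangent A Z p \<subseteq> tw_tangent A Z p \<and> fam_linear_on (tw_tangent A Z p) J \<and>
     (\<forall>\<xi>\<in>vertical A Z p. J \<xi> \<in> vertical A Z p \<and>
        (\<forall>u\<in>tangent_space A (fst p). vert_endo (J \<xi>) u = snd p (vert_endo \<xi> u))) \<and>
     (\<forall>\<xi>\<in>horizontal A nabla Z p. J \<xi> \<in> horizontal A nabla Z p \<and>
        d_pi (J \<xi>) = snd p (d_pi \<xi>))"

definition J_holomorphic ::
  "'a::t2_space chart set \<Rightarrow> 'a tpoint set \<Rightarrow> ('a tpoint \<Rightarrow> 'a ttvec \<Rightarrow> 'a ttvec) \<Rightarrow>
   'a tpoint set \<Rightarrow> ('a tpoint \<Rightarrow> complex) \<Rightarrow> bool" where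
  "J_holomorphic A Z J W f \<longleftrightarrow>
     (\<forall>p\<in>W. \<forall>\<xi>\<in>tw_tangent A Z p.
        tw_differential A Z f p (J p \<xi>) = \<i> * tw_differential A Z f p \<xi>)"

end

theory Submission
  imports Defs "HOL-Complex_Analysis.Cauchy_Integral_Formula"
begin

text \<open>In a chart of the surface a compatible complex structure is the real linear map
  \<open>a \<mapsto> P a + Q cnj a\<close> of the plane with \<open>P = \<i> (1 + r\<^sup>2) / (1 - r\<^sup>2)\<close>, \<open>Q = - 2 \<i> w / (1 - r\<^sup>2)\<close> and
  \<open>r = norm w\<close> (\<open>twistor_point_eq\<close>). Conversely \<open>w = - Q / (P + \<i>)\<close>, so that \<open>(z, w)\<close> depends differentiably on
  the endomorphism. Hence the tangent space of the twistor space consists of the vectors with arbitrary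
  components \<open>(v, \<eta>)\<close> in the chart \<open>(z, w)\<close> (\<open>tw_tangent_chart_point\<close>), and the differential of \<open>f\<close>
  is the derivative of its coordinate expression (\<open>tw_differential_coord_ttvec\<close>).

  The Levi-Civita connection of \<open>h dz d(cnj z)\<close> has the single Christoffel symbol \<open>\<Gamma> = h\<^sub>z / h\<close>
  (\<open>nabla_coord_vec\<close>). The covariant derivative of the canonical section along \<open>(v, \<eta>)\<close> is therefore the derivative of
  \<open>(P, Q)\<close> along \<open>\<eta>\<close> plus the commutator of multiplication by \<open>\<Gamma> v\<close> with \<open>j\<close>, which is
  \<open>a \<mapsto> (\<Gamma> v - cnj (\<Gamma> v)) Q cnj a\<close>. It vanishes iff \<open>\<eta> = - (\<Gamma> v - cnj (\<Gamma> v)) w\<close>, which describes the horizontal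
  space (\<open>coord_ttvec_horizontal_iff\<close>). On vertical vectors \<open>A \<mapsto> j A\<close> is \<open>\<eta> \<mapsto> \<i> \<eta>\<close> (\<open>J_vertical\<close>).

  A function is thus holomorphic on the fibres iff its derivative by \<open>cnj w\<close> vanishes. If so, its
  differential on the horizontal lift of \<open>v\<close> is \<open>\<alpha> v + \<beta> cnj v\<close> with
  \<open>\<alpha> = f\<^sub>z - w f\<^sub>w h\<^sub>z / h\<close> and \<open>\<beta> = f\<^bsub>cnj z\<^esub> + w f\<^sub>w h\<^bsub>cnj z\<^esub> / h\<close>. This form is complex linear for \<open>j\<close> iff it
  vanishes on the eigenvector \<open>\<partial>\<^bsub>cnj z\<^esub> + w \<partial>\<^sub>z\<close> for \<open>-\<i>\<close>, that is, iff
  \<open>\<beta> + w \<alpha> = 0\<close>. Multiplied by \<open>h\<close> this is the second equation (\<open>CR_equations_iff\<close>).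

  Tangent vectors are families of components in all charts. The vanishing of the covariant
  derivative thus has to be known in every chart, and this is where the transformation law of the
  Christoffel symbol (\<open>christoffel_change\<close>) enters.\<close>

section \<open>Wirtinger derivatives and smooth functions\<close>

lemma frechet_derivative_eqI:
  "(F has_derivative L) (at z) \<Longrightarrow> frechet_derivative F (at z) = L"
  by (metis frechet_derivative_at)

text \<open>Every real linear map of the plane is \<open>p v + q cnj v\<close>. For a derivative \<open>p\<close> and \<open>q\<close> are the
  Wirtinger derivatives; for a complex structure they will be its coordinates.\<close>

lemma real_linear_complex:
  fixes L :: "complex \<Rightarrow> complex"
  assumes "linear L"
  shows "L v = (L 1 - \<i> * L \<i>) / 2 * v + (L 1 + \<i> * L \<i>) / 2 * cnj v"
proof -
  have "v = Re v *\<^sub>R 1 + Im v *\<^sub>R \<i>"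
    by (simp add: complex_eq_iff)
  then have "L v = Re v *\<^sub>R L 1 + Im v *\<^sub>R L \<i>"
    by (metis assms linear_add linear_scale)
  then show ?thesis
    by (auto simp: complex_eq_iff algebra_simps) (auto simp: field_simps)
qed

lemma frechet_derivative_wirtinger:
  fixes F :: "complex \<Rightarrow> complex"
  assumes "F differentiable (at z)"
  shows "frechet_derivative F (at z) v = wirtinger F z * v + wirtinger_bar F z * cnj v"
  using real_linear_complex[OF linear_frechet_derivative[OF assms], of v]
  by (simp add: wirtinger_def wirtinger_bar_def)

lemma wirtinger_bar_of_real:
  fixes h :: "complex \<Rightarrow> real"
  assumes "h differentiable (at z)"
  shows "wirtinger_bar (\<lambda>z. complex_of_real (h z)) z
    = cnj (wirtinger (\<lambda>z. complex_of_real (h z)) z)"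
    "frechet_derivative h (at z) v = 2 * Re (wirtinger (\<lambda>z. complex_of_real (h z)) z * v)"
proof -
  define D where "D = frechet_derivative h (at z)"
  have D: "(h has_derivative D) (at z)"
    using assms D_def frechet_derivative_works by blast
  have *: "frechet_derivative (\<lambda>z. complex_of_real (h z)) (at z) = (\<lambda>v. complex_of_real (D v))"
    by (intro frechet_derivative_eqI has_derivative_of_real D)
  show bar: "wirtinger_bar (\<lambda>z. complex_of_real (h z)) z
      = cnj (wirtinger (\<lambda>z. complex_of_real (h z)) z)"
    unfolding wirtinger_def wirtinger_bar_def * by (simp add: complex_eq_iff)
  have "complex_of_real (D v) = wirtinger (\<lambda>z. complex_of_real (h z)) z * v
      + wirtinger_bar (\<lambda>z. complex_of_real (h z)) z * cnj v"
    using frechet_derivative_wirtinger[of "\<lambda>z. complex_of_real (h z)" z v]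
      differentiableI[OF has_derivative_of_real[OF D]] unfolding * by blast
  then have "complex_of_real (D v) = complex_of_real (2 * Re (wirtinger (\<lambda>z. complex_of_real (h z)) z * v))"
    unfolding bar by (metis complex_add_cnj complex_cnj_mult)
  then show "frechet_derivative h (at z) v = 2 * Re (wirtinger (\<lambda>z. complex_of_real (h z)) z * v)"
    unfolding D_def of_real_eq_iff .
qed

text \<open>Openness of \<open>S\<close> is essential: the derivative at a point of \<open>S\<close> depends on the values of the
  function nearby.\<close>

lemma Ck_on_cong:
  assumes "open S" "\<And>x. x \<in> S \<Longrightarrow> f x = f' x" "Ck_on k S f"
  shows "Ck_on k S f'"
  using assms
proof (induction k arbitrary: f f')
  case 0
  then show ?case
    by (simp cong: continuous_on_cong)
next
  case (Suc k)
  have d: "(f' has_derivative frechet_derivative f (at x)) (at x)" if "x \<in> S" for x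
    using Suc.prems that
    by (intro has_derivative_transform_within_open[of f _ x UNIV S f'])
      (auto simp: frechet_derivative_works)
  show ?case
    unfolding Ck_on.simps
  proof (intro conjI ballI allI)
    show "f' differentiable (at x)" if "x \<in> S" for x
      using d[OF that] by (auto simp: differentiable_def)
    show "Ck_on k S (\<lambda>x. frechet_derivative f' (at x) v)" for v
      by (rule Suc.IH[of "\<lambda>x. frechet_derivative f (at x) v"])
        (use Suc.prems frechet_derivative_eqI[OF d] in auto)
  qed
qed

text \<open>The directional derivative of a holomorphic function along \<open>v\<close> is \<open>deriv f x * v\<close>, which is again
  holomorphic, so the induction over the order of differentiability closes.\<close>

lemma holomorphic_imp_Cinf_on:
  assumes "open S" "f holomorphic_on S"
  shows "Cinf_on S f"
proof -
  have "Ck_on k S f" for k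
    using assms(2)
  proof (induction k arbitrary: f)
    case 0
    then show ?case
      by (simp add: holomorphic_on_imp_continuous_on)
  next
    case (Suc k)
    have d: "(f has_derivative (*) (deriv f x)) (at x)" if "x \<in> S" for x
      using holomorphic_derivI[OF Suc.prems \<open>open S\<close> that] by (simp add: has_field_derivative_def)
    have "Ck_on k S (\<lambda>x. deriv f x * v)" for v
      by (intro Suc.IH holomorphic_intros Suc.prems \<open>open S\<close>)
    moreover have "frechet_derivative f (at x) v = deriv f x * v" if "x \<in> S" for x v
      by (simp add: frechet_derivative_eqI[OF d[OF that]])
    ultimately have "Ck_on k S (\<lambda>x. frechet_derivative f (at x) v)" for v
      using Ck_on_cong[OF \<open>open S\<close>, of "\<lambda>x. deriv f x * v" "\<lambda>x. frechet_derivative f (at x) v" k]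
      by simp
    then show ?case
      using d by (auto simp: differentiable_def)
  qed
  then show ?thesis
    by (simp add: Cinf_on_def)
qed

lemma Cinf_on_imp_differentiable: "Cinf_on S f \<Longrightarrow> x \<in> S \<Longrightarrow> f differentiable (at x)"
  unfolding Cinf_on_def by (metis Ck_on.simps(2))

section \<open>Charts and tangent vectors of a Riemann surface\<close>

locale surface =
  fixes A :: "'a::t2_space chart set"
  assumes riemann_surface: "riemann_surface A"
begin

lemma
  assumes "c \<in> A"
  shows open_cdom: "open (cdom c)"
    and open_cimg: "open (cimg c)"
    and continuous_on_cinv: "continuous_on (cimg c) (cinv c)"
    and cinv_coord: "x \<in> cdom c \<Longrightarrow> cinv c (coord c x) = x"
    and coord_cinv: "z \<in> cimg c \<Longrightarrow> coord c (cinv c z) = z"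
    and cinv_in_cdom: "z \<in> cimg c \<Longrightarrow> cinv c z \<in> cdom c"
    and coord_in_cimg: "x \<in> cdom c \<Longrightarrow> coord c x \<in> cimg c"
proof -
  have h: "open (cdom c)" "open (cimg c)" "homeomorphism (cdom c) (cimg c) (coord c) (cinv c)"
    using riemann_surface assms by (auto simp: riemann_surface_def)
  show "open (cdom c)" "open (cimg c)"
    "continuous_on (cimg c) (cinv c)"
    "x \<in> cdom c \<Longrightarrow> cinv c (coord c x) = x" "z \<in> cimg c \<Longrightarrow> coord c (cinv c z) = z"
    "z \<in> cimg c \<Longrightarrow> cinv c z \<in> cdom c" "x \<in> cdom c \<Longrightarrow> coord c x \<in> cimg c"
    using h by (auto simp: homeomorphism_def)
qed

lemma ex_chart: "\<exists>c\<in>A. x \<in> cdom c"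
  using riemann_surface unfolding riemann_surface_def by blast

abbreviation overlap :: "'a chart \<Rightarrow> 'a chart \<Rightarrow> complex set" where
  "overlap c d \<equiv> coord c ` (cdom c \<inter> cdom d)"

lemma overlap_iff:
  assumes "c \<in> A"
  shows "z \<in> overlap c d \<longleftrightarrow> z \<in> cimg c \<and> cinv c z \<in> cdom d"
proof
  show "z \<in> cimg c \<and> cinv c z \<in> cdom d" if "z \<in> overlap c d"
    using that assms by (auto simp: cinv_coord coord_in_cimg)
  show "z \<in> overlap c d" if "z \<in> cimg c \<and> cinv c z \<in> cdom d"
    using that assms by (intro rev_image_eqI[of "cinv c z"]) (auto simp: cinv_in_cdom coord_cinv)
qed

lemma open_overlap:
  assumes "c \<in> A" "d \<in> A"
  shows "open (overlap c d)"
proof -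
  have "overlap c d = cimg c \<inter> cinv c -` cdom d"
    using overlap_iff[OF assms(1)] by blast
  then show ?thesis
    using assms continuous_open_preimage[OF continuous_on_cinv open_cimg open_cdom] by simp
qed

lemma transition_holomorphic: "c \<in> A \<Longrightarrow> d \<in> A \<Longrightarrow> transition c d holomorphic_on overlap c d"
  using riemann_surface by (auto simp: riemann_surface_def)

abbreviation jac :: "'a chart \<Rightarrow> 'a chart \<Rightarrow> complex \<Rightarrow> complex" where
  "jac c d \<equiv> deriv (transition c d)"

lemma transition_has_derivative:
  assumes "c \<in> A" "d \<in> A" "z \<in> overlap c d"
  shows "(transition c d has_field_derivative jac c d z) (at z)"
  using assms by (intro holomorphic_derivI[OF transition_holomorphic open_overlap])

lemma jac_holomorphic: "c \<in> A \<Longrightarrow> d \<in> A \<Longrightarrow> jac c d holomorphic_on overlap c d"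
  by (intro holomorphic_deriv transition_holomorphic open_overlap)

lemma jac_has_derivative:
  assumes "c \<in> A" "d \<in> A" "z \<in> overlap c d"
  shows "(jac c d has_field_derivative deriv (jac c d) z) (at z)"
  using assms by (intro holomorphic_derivI[OF jac_holomorphic open_overlap])

lemma jac_refl:
  assumes "c \<in> A" "z \<in> cimg c"
  shows "jac c c z = 1"
proof -
  have "(transition c c has_field_derivative 1) (at z)"
    using assms open_cimg[OF assms(1)]
    by (intro has_field_derivative_transform_within_open[where S = "cimg c", OF DERIV_ident])
      (auto simp: transition_def coord_cinv)
  then show ?thesis
    by (rule DERIV_imp_deriv)
qed

lemma jac_cocycle:
  assumes "c \<in> A" "d \<in> A" "e \<in> A" "x \<in> cdom c" "x \<in> cdom d" "x \<in> cdom e"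
  shows "jac c e (coord c x) = jac d e (coord d x) * jac c d (coord c x)"
proof -
  define z where "z = coord c x"
  have tz: "transition c d z = coord d x"
    by (simp add: z_def transition_def cinv_coord assms)
  have z: "z \<in> overlap c d \<inter> overlap c e"
    using assms by (auto simp: z_def)
  have "((\<lambda>y. transition d e (transition c d y)) has_field_derivative
      jac d e (transition c d z) * jac c d z) (at z)"
    by (rule DERIV_chain2)
       (use z assms tz in \<open>auto intro!: transition_has_derivative\<close>)
  moreover have "transition d e (transition c d y) = transition c e y" if "y \<in> overlap c d" for y
    using that assms by (auto simp: transition_def cinv_coord)
  ultimately have "(transition c e has_field_derivative jac d e (transition c d z) * jac c d z) (at z)"
    using has_field_derivative_transform_within_open[where S = "overlap c d" and g = "transition c e"]
      open_overlap[OF assms(1,2)] z by blast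
  then show ?thesis
    using DERIV_imp_deriv tz z_def by fastforce
qed

lemma jac_nonzero:
  assumes "c \<in> A" "d \<in> A" "x \<in> cdom c" "x \<in> cdom d"
  shows "jac c d (coord c x) \<noteq> 0"
  using jac_cocycle[of c d c x] jac_refl[of c "coord c x"] assms
  by (auto simp: coord_in_cimg)

lemma coord_vec_in:
  assumes "c \<in> A" "x \<in> cdom c"
  shows "coord_vec A c a x \<in> tangent_space A x"
proof -
  have "coord_vec A c a x e = jac d e (coord d x) * coord_vec A c a x d"
    if "d \<in> charts_at A x" "e \<in> charts_at A x" for d e
  proof -
    have "jac c e (coord c x) = jac d e (coord d x) * jac c d (coord c x)"
      using that assms by (intro jac_cocycle) (auto simp: charts_at_def)
    then show ?thesis
      using that by (simp add: coord_vec_def)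
  qed
  moreover have "coord_vec A c a x d = 0" if "d \<notin> charts_at A x" for d
    using that by (simp add: coord_vec_def)
  ultimately show ?thesis
    unfolding tangent_space_def by blast
qed

lemma coord_vec_self: "c \<in> A \<Longrightarrow> x \<in> cdom c \<Longrightarrow> coord_vec A c a x c = a"
  by (simp add: coord_vec_def charts_at_def jac_refl coord_in_cimg)

lemma coord_vec_comp:
  "d \<in> A \<Longrightarrow> x \<in> cdom d \<Longrightarrow> coord_vec A c a x d = jac c d (coord c x) * a"
  by (simp add: coord_vec_def charts_at_def)

text \<open>A tangent vector is determined by its component in one chart, so that all tensors below can be
  evaluated there.\<close>

lemma coord_vec_of_comp:
  assumes "c \<in> A" "x \<in> cdom c" "u \<in> tangent_space A x"
  shows "coord_vec A c (u c) x = u"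
proof
  fix d
  have "c \<in> charts_at A x"
    using assms by (simp add: charts_at_def)
  then have "d \<in> charts_at A x \<Longrightarrow> u d = jac c d (coord c x) * u c"
    and "d \<notin> charts_at A x \<Longrightarrow> u d = 0"
    using assms(3) unfolding tangent_space_def by blast+
  then show "coord_vec A c (u c) x d = u d"
    by (simp add: coord_vec_def)
qed

lemma coord_vec_change:
  assumes "c \<in> A" "d \<in> A" "x \<in> cdom c" "x \<in> cdom d"
  shows "coord_vec A c a x = coord_vec A d (jac c d (coord c x) * a) x"
  by (metis assms coord_vec_comp coord_vec_in coord_vec_of_comp)

lemma coord_vec_add: "coord_vec A c a x +\<^sub>t coord_vec A c b x = coord_vec A c (a + b) x"
  by (auto simp: coord_vec_def algebra_simps)

lemma coord_vec_scale: "r *\<^sub>t coord_vec A c a x = coord_vec A c (r *\<^sub>R a) x"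
  by (auto simp: coord_vec_def)

lemma coord_vec_rot: "rot (coord_vec A c a x) = coord_vec A c (\<i> * a) x"
  by (auto simp: coord_vec_def rot_def)

lemma coord_vec_zero: "coord_vec A c 0 x = 0\<^sub>t"
  by (auto simp: coord_vec_def)

lemma tangent_add:
  assumes "u \<in> tangent_space A x" "v \<in> tangent_space A x"
  shows "u +\<^sub>t v \<in> tangent_space A x"
proof -
  obtain c where c: "c \<in> A" "x \<in> cdom c"
    using ex_chart by blast
  have "coord_vec A c (u c) x +\<^sub>t coord_vec A c (v c) x \<in> tangent_space A x"
    unfolding coord_vec_add by (rule coord_vec_in[OF c])
  then show ?thesis
    by (simp only: coord_vec_of_comp[OF c assms(1)] coord_vec_of_comp[OF c assms(2)])
qed

lemma tangent_scale:
  assumes "u \<in> tangent_space A x"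
  shows "r *\<^sub>t u \<in> tangent_space A x"
proof -
  obtain c where c: "c \<in> A" "x \<in> cdom c"
    using ex_chart by blast
  have "r *\<^sub>t coord_vec A c (u c) x \<in> tangent_space A x"
    unfolding coord_vec_scale by (rule coord_vec_in[OF c])
  then show ?thesis
    by (simp only: coord_vec_of_comp[OF c assms])
qed

text \<open>The coordinate fields of a chart are smooth because their components in the other charts are
  derivatives of transition maps, hence holomorphic. They are the fields on which the connection
  is evaluated.\<close>

lemma smooth_vf_coord_vec:
  assumes "c \<in> A"
  shows "smooth_vf A (cdom c) (coord_vec A c a)"
  unfolding smooth_vf_def
proof (intro conjI ballI)
  fix d assume d: "d \<in> A"
  have "transition d c ` overlap d c \<subseteq> overlap c d"
  proof (rule image_subsetI)
    fix z assume "z \<in> overlap d c"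
    then obtain x where "z = coord d x" "x \<in> cdom d" "x \<in> cdom c"
      by blast
    then show "transition d c z \<in> overlap c d"
      using cinv_coord[OF d, of x] by (simp add: transition_def)
  qed
  then have "(jac c d \<circ> transition d c) holomorphic_on overlap d c"
    by (rule holomorphic_on_compose_gen[OF transition_holomorphic jac_holomorphic, OF d assms assms d])
  then have "(\<lambda>z. jac c d (transition d c z) * a) holomorphic_on overlap d c"
    unfolding o_def by (rule holomorphic_on_mult[OF _ holomorphic_on_const])
  then have "Cinf_on (overlap d c) (\<lambda>z. jac c d (transition d c z) * a)"
    by (rule holomorphic_imp_Cinf_on[OF open_overlap[OF d assms]])
  moreover have "jac c d (transition d c z) * a = coord_vec A c a (cinv d z) d"
    if "z \<in> overlap d c" for z
  proof -
    have "cinv d z \<in> cdom d"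
      using that overlap_iff[OF d] cinv_in_cdom[OF d] by blast
    then show ?thesis
      using coord_vec_comp[OF d] by (simp add: transition_def)
  qed
  ultimately have "Ck_on k (overlap d c) (\<lambda>z. coord_vec A c a (cinv d z) d)" for k
    using Ck_on_cong[OF open_overlap[OF d assms], of "\<lambda>z. jac c d (transition d c z) * a"
        "\<lambda>z. coord_vec A c a (cinv d z) d" k]
    unfolding Cinf_on_def by blast
  then show "Cinf_on (coord d ` (cdom c \<inter> cdom d)) (\<lambda>z. coord_vec A c a (cinv d z) d)"
    by (simp add: Cinf_on_def Int_commute)
qed (auto intro: assms coord_vec_in)

end

section \<open>Conformal metrics and their Levi-Civita connection\<close>

lemma Re_of_real_mult: "Re (complex_of_real r * z) = r * Re z"
  by simp

lemma Re_mult_cnj_self: "Re (z * cnj z) = (norm z)\<^sup>2"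
  unfolding cmod_power2 by (simp add: power2_eq_square)

locale conformal_surface = surface A for A :: "'a::t2_space chart set" +
  fixes g :: "'a \<Rightarrow> 'a tvec \<Rightarrow> 'a tvec \<Rightarrow> real"
  assumes conformal: "conformal_metric A g"
begin

abbreviation factor :: "'a chart \<Rightarrow> complex \<Rightarrow> real" where
  "factor c \<equiv> conformal_factor A g c"

lemma metric_sym: "u \<in> tangent_space A x \<Longrightarrow> v \<in> tangent_space A x \<Longrightarrow> g x u v = g x v u"
  and metric_add: "u \<in> tangent_space A x \<Longrightarrow> v \<in> tangent_space A x \<Longrightarrow> w \<in> tangent_space A x
    \<Longrightarrow> g x (u +\<^sub>t v) w = g x u w + g x v w"
  and metric_scale: "u \<in> tangent_space A x \<Longrightarrow> w \<in> tangent_space A x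
    \<Longrightarrow> g x (r *\<^sub>t u) w = r * g x u w"
  and metric_pos: "u \<in> tangent_space A x \<Longrightarrow> u \<noteq> 0\<^sub>t \<Longrightarrow> g x u u > 0"
  and metric_rot: "u \<in> tangent_space A x \<Longrightarrow> v \<in> tangent_space A x \<Longrightarrow> g x (rot u) (rot v) = g x u v"
  using conformal unfolding conformal_metric_def Let_def by blast+

text \<open>Multiplication by \<open>\<i>\<close> is an isometry, which makes \<open>1\<close> and \<open>\<i>\<close> orthogonal vectors of equal
  length: a conformal metric has a single coefficient in each chart.\<close>

lemma metric_coord_vec:
  assumes "c \<in> A" "x \<in> cdom c"
  shows "g x (coord_vec A c a x) (coord_vec A c b x) = factor c (coord c x) * Re (a * cnj b)"
proof -
  define G where "G a b = g x (coord_vec A c a x) (coord_vec A c b x)" for a b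
  note T = coord_vec_in[OF assms]
  have sym: "G a b = G b a" for a b
    by (simp add: G_def metric_sym[OF T T])
  have add: "G (a + b) e = G a e + G b e" for a b e
    using metric_add[OF T T T] by (simp add: G_def coord_vec_add)
  have scale: "G (r *\<^sub>R a) e = r * G a e" for r a e
    using metric_scale[OF T T] by (simp add: G_def coord_vec_scale)
  have rot: "G (\<i> * a) (\<i> * b) = G a b" for a b
    using metric_rot[OF T T] by (simp add: G_def coord_vec_rot)
  have "a = Re a *\<^sub>R 1 + Im a *\<^sub>R \<i>" for a
    by (simp add: complex_eq_iff)
  then have left: "G a e = Re a * G 1 e + Im a * G \<i> e" for a e
    by (metis add scale)
  have ii: "G \<i> \<i> = G 1 1"
    using rot[of 1 1] by simp
  have "G 1 \<i> = G \<i> (-1)"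
    using rot[of 1 "\<i>"] by simp
  also have "\<dots> = - G 1 \<i>"
    using scale[of "-1" 1 "\<i>"] by (simp add: sym[of "\<i>"])
  finally have "G 1 \<i> = 0"
    by simp
  then have row: "G 1 b = Re b * G 1 1" "G \<i> b = Im b * G 1 1" for b
    unfolding sym[of _ b] left[of b] sym[of \<i> 1] ii by simp_all
  have G: "G a b = (Re a * Re b + Im a * Im b) * G 1 1" for a b
    unfolding left[of a b] row[of b] by (simp only: distrib_right mult.assoc)
  have f: "factor c (coord c x) = 2 * (G (1/2) (1/2) - G (- \<i>/2) (\<i>/2))"
    by (simp add: conformal_factor_def metric_C_def partial_z_def partial_zbar_def
        cinv_coord[OF assms] G_def)
  have "factor c (coord c x) = G 1 1"
    unfolding f G[of "1/2" "1/2"] G[of "- \<i>/2" "\<i>/2"] by simp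
  then have "G a b = factor c (coord c x) * Re (a * cnj b)"
    unfolding G[of a b] by simp
  then show ?thesis
    by (simp add: G_def)
qed

lemma metric_formula:
  assumes "c \<in> A" "x \<in> cdom c" "u \<in> tangent_space A x" "v \<in> tangent_space A x"
  shows "g x u v = factor c (coord c x) * Re (u c * cnj (v c))"
  using metric_coord_vec[OF assms(1,2), of "u c" "v c"] by (simp add: coord_vec_of_comp assms)

lemma factor_pos:
  assumes "c \<in> A" "x \<in> cdom c"
  shows "factor c (coord c x) > 0"
proof -
  have "coord_vec A c 1 x \<noteq> 0\<^sub>t"
    using coord_vec_self[OF assms, of 1] by (metis zero_neq_one)
  then show ?thesis
    using metric_pos[OF coord_vec_in[OF assms], of 1] metric_coord_vec[OF assms, of 1 1] by simp
qed

lemma factor_differentiable: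
  assumes "c \<in> A" "z \<in> cimg c"
  shows "factor c differentiable (at z)"
proof -
  have d: "(\<lambda>z. g (cinv c z) (coord_vec A c a (cinv c z)) (coord_vec A c b (cinv c z)))
      differentiable (at z)" for a b
    using conformal assms Cinf_on_imp_differentiable unfolding conformal_metric_def by blast
  have "factor c = (\<lambda>z. 2 * (g (cinv c z) (coord_vec A c (1/2) (cinv c z)) (coord_vec A c (1/2) (cinv c z))
      - g (cinv c z) (coord_vec A c (-\<i>/2) (cinv c z)) (coord_vec A c (\<i>/2) (cinv c z))))"
    by (simp add: fun_eq_iff conformal_factor_def metric_C_def partial_z_def partial_zbar_def)
  then show ?thesis
    by (simp add: d differentiable_diff differentiable_mult)
qed

text \<open>The conformal factor is the squared length of the coordinate vector \<open>1\<close>, which the transition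
  map multiplies by its derivative.\<close>

lemma factor_change:
  assumes "c \<in> A" "d \<in> A" "z \<in> overlap c d"
  shows "factor c z = factor d (transition c d z) * (norm (jac c d z))\<^sup>2"
proof -
  obtain x where x: "z = coord c x" "x \<in> cdom c" "x \<in> cdom d"
    using assms(3) by blast
  have t: "transition c d z = coord d x"
    using assms x by (simp add: transition_def cinv_coord)
  have "factor c z = g x (coord_vec A c 1 x) (coord_vec A c 1 x)"
    using metric_coord_vec[of c x 1 1] assms x by simp
  also have "\<dots> = factor d (coord d x) * Re (jac c d z * cnj (jac c d z))"
    using metric_coord_vec[of d x "jac c d z" "jac c d z"] coord_vec_change[of c d x 1] assms x by simp
  also have "Re (jac c d z * cnj (jac c d z)) = (norm (jac c d z))\<^sup>2"
    by (rule Re_mult_cnj_self)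
  finally show ?thesis
    by (simp add: t)
qed

text \<open>The \<open>z\<close>-derivative of \<open>log h\<close>.\<close>

definition christoffel :: "'a chart \<Rightarrow> complex \<Rightarrow> complex" where
  "christoffel c z = wirtinger (\<lambda>z. complex_of_real (factor c z)) z / complex_of_real (factor c z)"

lemma factor_derivative:
  assumes "c \<in> A" "z \<in> cimg c"
  shows "(factor c has_derivative (\<lambda>v. 2 * factor c z * Re (christoffel c z * v))) (at z)"
proof -
  have p: "factor c z > 0"
    using factor_pos[of c "cinv c z"] assms by (simp add: cinv_in_cdom coord_cinv)
  have "(factor c has_derivative frechet_derivative (factor c) (at z)) (at z)"
    using factor_differentiable[OF assms] frechet_derivative_works by blast
  moreover have "frechet_derivative (factor c) (at z) = (\<lambda>v. 2 * factor c z * Re (christoffel c z * v))"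
  proof
    fix v
    have "wirtinger (\<lambda>z. complex_of_real (factor c z)) z * v
        = complex_of_real (factor c z) * (christoffel c z * v)"
      using p by (simp add: christoffel_def)
    then show "frechet_derivative (factor c) (at z) v = 2 * factor c z * Re (christoffel c z * v)"
      using wirtinger_bar_of_real(2)[OF factor_differentiable[OF assms], of v]
      by (simp only: Re_of_real_mult mult.assoc)
  qed
  ultimately show ?thesis
    by simp
qed

text \<open>The inhomogeneous transformation law of a connection form. It is the logarithmic
  derivative of the transformation law of the conformal factor: real parts of \<open>christoffel c z * v\<close>
  are compared for all directions \<open>v\<close>.\<close>

lemma christoffel_change:
  assumes "c \<in> A" "d \<in> A" "z \<in> overlap c d"
  shows "christoffel c z
    = christoffel d (transition c d z) * jac c d z + deriv (jac c d) z / jac c d z"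
proof -
  define t u k where "t = transition c d z" and "u = jac c d z" and "k = deriv (jac c d) z"
  define h where "h = factor d t"
  obtain x where x: "z = coord c x" "x \<in> cdom c" "x \<in> cdom d"
    using assms(3) by blast
  have tx: "t = coord d x"
    using assms x by (simp add: transition_def cinv_coord t_def)
  have u: "u \<noteq> 0"
    using jac_nonzero[OF assms(1,2)] x by (simp add: u_def)
  have h: "h > 0"
    using factor_pos[OF assms(2)] x tx by (simp add: h_def)
  have dt: "(transition c d has_derivative (*) u) (at z)"
    using transition_has_derivative[OF assms] by (simp add: has_field_derivative_def u_def)
  have du: "(jac c d has_derivative (*) k) (at z)"
    using jac_has_derivative[OF assms] by (simp add: has_field_derivative_def k_def)
  have dh: "(factor d has_derivative (\<lambda>v. 2 * h * Re (christoffel d t * v))) (at t)"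
    using factor_derivative[OF assms(2), of t] x coord_in_cimg[OF assms(2)] by (simp add: tx h_def)
  have dh': "((\<lambda>z. factor d (transition c d z)) has_derivative
      (\<lambda>v. 2 * h * Re (christoffel d t * (u * v)))) (at z)"
    using has_derivative_compose[OF dt dh[unfolded t_def]] by (simp add: t_def)
  have dn: "((\<lambda>z. Re (jac c d z * cnj (jac c d z))) has_derivative
      (\<lambda>v. Re (u * cnj (k * v) + (k * v) * cnj u))) (at z)"
    unfolding u_def
    by (intro has_derivative_Re has_derivative_mult has_derivative_cnj du)
  have "((\<lambda>z. factor d (transition c d z) * Re (jac c d z * cnj (jac c d z))) has_derivative
      (\<lambda>v. h * Re (u * cnj (k * v) + (k * v) * cnj u)
        + 2 * h * Re (christoffel d t * (u * v)) * Re (u * cnj u))) (at z)"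
    using has_derivative_mult[OF dh' dn] by (simp add: h_def t_def u_def)
  moreover have eq: "factor d (transition c d z) * Re (jac c d z * cnj (jac c d z)) = factor c z"
    if "z \<in> overlap c d" for z
    using factor_change[OF assms(1,2) that] by (simp only: Re_mult_cnj_self)
  ultimately have "(factor c has_derivative (\<lambda>v. h * Re (u * cnj (k * v) + (k * v) * cnj u)
        + 2 * h * Re (christoffel d t * (u * v)) * Re (u * cnj u))) (at z)"
    using has_derivative_transform_within_open[OF _ open_overlap[OF assms(1,2)] assms(3)] by blast
  moreover have "(factor c has_derivative (\<lambda>v. 2 * factor c z * Re (christoffel c z * v))) (at z)"
    using factor_derivative[OF assms(1)] x coord_in_cimg[OF assms(1)] by simp
  ultimately have "(\<lambda>v. h * Re (u * cnj (k * v) + (k * v) * cnj u)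
        + 2 * h * Re (christoffel d t * (u * v)) * Re (u * cnj u))
      = (\<lambda>v. 2 * factor c z * Re (christoffel c z * v))"
    by (rule has_derivative_unique)
  then have *: "h * Re (u * cnj (k * v) + (k * v) * cnj u)
      + 2 * h * Re (christoffel d t * (u * v)) * Re (u * cnj u)
      = 2 * (h * Re (u * cnj u)) * Re (christoffel c z * v)" for v
    using eq[OF assms(3)] by (simp add: fun_eq_iff h_def t_def u_def)
  have "2 * h * Re (u * cnj u) * Re ((christoffel d t * u + k / u) * v)
      = 2 * h * Re (u * cnj u) * Re (christoffel c z * v)" for v
  proof -
    have "complex_of_real (Re (u * cnj u)) = u * cnj u"
      by (simp add: complex_eq_iff)
    then have "k * v * cnj u = complex_of_real (Re (u * cnj u)) * (k / u * v)"
      using u by simp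
    then have "Re (k * v * cnj u) = Re (u * cnj u) * Re (k / u * v)"
      by (simp only: Re_of_real_mult)
    moreover have "Re (u * cnj (k * v)) = Re (k * v * cnj u)"
      by (simp add: algebra_simps)
    ultimately have "Re (u * cnj (k * v) + k * v * cnj u) = 2 * Re (u * cnj u) * Re (k / u * v)"
      by simp
    then show ?thesis
      using *[of v] by (simp add: algebra_simps del: times_complex.sel)
  qed
  moreover have "Re (u * cnj u) > 0"
    using u by (simp only: Re_mult_cnj_self) simp
  ultimately have *: "Re ((christoffel d t * u + k / u) * v) = Re (christoffel c z * v)" for v
    using h unfolding mult_cancel_left by fastforce
  have "christoffel d t * u + k / u = christoffel c z"
    using *[of 1] *[of "\<i>"] by (simp add: complex_eq_iff)
  then show ?thesis
    by (simp add: t_def u_def k_def)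
qed

end

locale levi_civita_surface = conformal_surface A g for A :: "'a::t2_space chart set" and g +
  fixes nabla :: "'a connection"
  assumes levi_civita: "levi_civita A g nabla"
begin

lemma nabla_in:
  assumes "c \<in> A" "x \<in> cdom c" "v \<in> tangent_space A x"
  shows "nabla x v (coord_vec A c a) \<in> tangent_space A x"
proof -
  have "\<forall>U Y. open U \<and> smooth_vf A U Y \<longrightarrow>
      (\<forall>x\<in>U. \<forall>v\<in>tangent_space A x. nabla x v Y \<in> tangent_space A x)"
    using levi_civita unfolding levi_civita_def affine_connection_def by meson
  then show ?thesis
    using open_cdom[OF assms(1)] smooth_vf_coord_vec[OF assms(1)] assms(2,3) by blast
qed

text \<open>The uniqueness half of the fundamental theorem of Riemannian geometry. Let \<open>K\<close> be the difference
  between the connection and the claimed formula on coordinate fields. Vanishing torsion makes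
  \<open>K a b\<close> symmetric, and compatibility with the metric makes \<open>\<langle>K a b, e\<rangle>\<close> antisymmetric
  in \<open>b\<close> and \<open>e\<close>. A trilinear form with both symmetries is zero.\<close>

lemma nabla_coord_vec:
  assumes "c \<in> A" "x \<in> cdom c" "v \<in> tangent_space A x"
  shows "nabla x v (coord_vec A c b) c = christoffel c (coord c x) * v c * b"
proof -
  define z where "z = coord c x"
  define N where "N a b = nabla x (coord_vec A c a x) (coord_vec A c b) c" for a b
  define K where "K a b = N a b - christoffel c z * a * b" for a b
  note T = coord_vec_in[OF assms(1,2)]
  note sm = smooth_vf_coord_vec[OF assms(1)]
  have z: "z \<in> cimg c"
    using assms coord_in_cimg z_def by blast
  have cc: "c \<in> charts_at A x"
    using assms by (simp add: charts_at_def)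
  have const: "frechet_derivative (\<lambda>y. coord_vec A c a (cinv c y) c) (at z) = (\<lambda>_. 0)" for a
    by (intro frechet_derivative_eqI has_derivative_transform_within_open
        [OF has_derivative_const open_cimg[OF assms(1)] z])
       (simp add: coord_vec_self assms(1) cinv_in_cdom)
  have lc: "nabla x (X x) Y -\<^sub>t nabla x (Y x) X = lie_bracket A X Y x"
      "v \<in> tangent_space A x \<Longrightarrow> dir_deriv c (\<lambda>y. g y (X y) (Y y)) x v
        = g x (nabla x v X) (Y x) + g x (X x) (nabla x v Y)"
    if "smooth_vf A (cdom c) X" "smooth_vf A (cdom c) Y" for X Y v
    using levi_civita[unfolded levi_civita_def, THEN conjunct2, rule_format, of "cdom c" X Y]
      open_cdom[OF assms(1)] that assms(2) cc by simp_all
  have "N a b - N b a = lie_bracket A (coord_vec A c a) (coord_vec A c b) x c" for a b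
    unfolding N_def by (rule fun_cong[OF lc(1)[OF sm sm]])
  then have torsion: "K a b = K b a" for a b
    using cc const by (simp add: lie_bracket_def K_def z_def)
  have metric: "Re (K v a * cnj b) = - Re (K v b * cnj a)" for v a b
  proof -
    have "dir_deriv c (\<lambda>y. g y (coord_vec A c a y) (coord_vec A c b y)) x (coord_vec A c v x)
      = g x (nabla x (coord_vec A c v x) (coord_vec A c a)) (coord_vec A c b x)
      + g x (coord_vec A c a x) (nabla x (coord_vec A c v x) (coord_vec A c b))"
      by (rule lc(2)[OF sm sm T])
    also have "\<dots> = factor c z * (Re (N v a * cnj b) + Re (a * cnj (N v b)))"
      using metric_formula[OF assms(1,2) nabla_in[OF assms(1,2) T] T]
        metric_formula[OF assms(1,2) T nabla_in[OF assms(1,2) T]]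
      by (simp add: N_def z_def coord_vec_self assms(1,2) algebra_simps)
    finally have 1: "dir_deriv c (\<lambda>y. g y (coord_vec A c a y) (coord_vec A c b y)) x (coord_vec A c v x)
      = factor c z * (Re (N v a * cnj b) + Re (a * cnj (N v b)))" .
    have "((\<lambda>y. factor c y * Re (a * cnj b)) has_derivative
        (\<lambda>v. 2 * factor c z * Re (christoffel c z * v) * Re (a * cnj b))) (at z)"
      by (intro has_derivative_mult_left factor_derivative assms z)
    then have "(((\<lambda>y. g y (coord_vec A c a y) (coord_vec A c b y)) \<circ> cinv c) has_derivative
        (\<lambda>v. 2 * factor c z * Re (christoffel c z * v) * Re (a * cnj b))) (at z)"
      by (rule has_derivative_transform_within_open[OF _ open_cimg[OF assms(1)] z])
         (simp add: metric_coord_vec assms(1) cinv_in_cdom coord_cinv)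
    then have "dir_deriv c (\<lambda>y. g y (coord_vec A c a y) (coord_vec A c b y)) x (coord_vec A c v x)
      = 2 * factor c z * Re (christoffel c z * v) * Re (a * cnj b)"
      using assms(1,2) by (simp add: dir_deriv_def frechet_derivative_eqI z_def coord_vec_self)
    with 1 have "factor c z * (Re (N v a * cnj b) + Re (a * cnj (N v b)))
      = 2 * factor c z * Re (christoffel c z * v) * Re (a * cnj b)"
      by metis
    also have "\<dots> = factor c z * (2 * Re (christoffel c z * v) * Re (a * cnj b))"
      by (simp only: mult.assoc mult.left_commute[of 2])
    finally have "factor c z * (Re (N v a * cnj b) + Re (a * cnj (N v b)))
      = factor c z * (2 * Re (christoffel c z * v) * Re (a * cnj b))" .
    then have "Re (N v a * cnj b) + Re (a * cnj (N v b)) = 2 * Re (christoffel c z * v) * Re (a * cnj b)"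
      using factor_pos[OF assms(1,2)] unfolding mult_cancel_left z_def by linarith
    then show ?thesis
      by (simp add: K_def algebra_simps)
  qed
  \<comment> \<open>Alternating the two symmetries three times each returns to the start with the opposite sign.\<close>
  have "Re (K a b * cnj e) = 0" for a b e
  proof -
    have "Re (K a b * cnj e) = - Re (K e a * cnj b)"
      using metric[of a b e] torsion[of a e] by simp
    also have "\<dots> = Re (K b e * cnj a)"
      using metric[of e a b] torsion[of e b] by simp
    also have "\<dots> = - Re (K a b * cnj e)"
      using metric[of b e a] torsion[of b a] by simp
    finally show ?thesis
      by linarith
  qed
  from this[of "v c" b "K (v c) b"] have "K (v c) b = 0"
    by (simp only: Re_mult_cnj_self) simp
  then show ?thesis
    by (simp add: K_def N_def z_def coord_vec_of_comp assms)
qed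

end

section \<open>Compatible complex structures and the unit disc\<close>

text \<open>The real linear endomorphisms of the plane, by their complex linear and antilinear parts.\<close>

definition rlin :: "complex \<Rightarrow> complex \<Rightarrow> complex \<Rightarrow> complex" where
  "rlin p q a = p * a + q * cnj a"

text \<open>The numbers \<open>jP w\<close> and \<open>jQ w\<close> are the two parts of the complex structure whose eigenline for \<open>\<i>\<close>
  is spanned by \<open>\<partial>\<^sub>z + cnj w \<partial>\<^bsub>cnj z\<^esub>\<close>. With \<open>r = norm w\<close> they are
  \<open>\<i> (1 + r\<^sup>2) / (1 - r\<^sup>2)\<close> and \<open>- 2 \<i> w / (1 - r\<^sup>2)\<close>. Writing both through the single
  function \<open>disc_weight w = 1 / (1 - r\<^sup>2)\<close> reduces all identities between them to
  \<open>w * cnj w * disc_weight w = disc_weight w - 1\<close>.\<close>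

definition disc_weight :: "complex \<Rightarrow> complex" where
  "disc_weight w = inverse (1 - w * cnj w)"

definition jP :: "complex \<Rightarrow> complex" where
  "jP w = \<i> * (2 * disc_weight w - 1)"

definition jQ :: "complex \<Rightarrow> complex" where
  "jQ w = - 2 * \<i> * w * disc_weight w"

lemma cnj_disc_weight [simp]: "cnj (disc_weight w) = disc_weight w"
  by (simp add: disc_weight_def mult.commute)

lemma disc_nonzero:
  assumes "norm w < 1"
  shows "1 - w * cnj w \<noteq> 0"
proof
  assume "1 - w * cnj w = 0"
  then have "Re (w * cnj w) = 1"
    by (metis eq_iff_diff_eq_0 one_complex.sel(1))
  then have "(norm w)\<^sup>2 = 1"
    by (simp only: Re_mult_cnj_self)
  then show False
    using assms norm_ge_zero[of w] by (auto simp: power2_eq_1_iff)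
qed

lemma disc_weight_pos:
  assumes "norm w < 1"
  shows "disc_weight w = complex_of_real (inverse (1 - (norm w)\<^sup>2))" "inverse (1 - (norm w)\<^sup>2) > 0"
proof -
  show "disc_weight w = complex_of_real (inverse (1 - (norm w)\<^sup>2))"
    unfolding disc_weight_def complex_norm_square[symmetric] by simp
  show "inverse (1 - (norm w)\<^sup>2) > 0"
    using assms by (simp add: power_less_one_iff abs_square_less_1)
qed

lemma disc_weight_nonzero: "norm w < 1 \<Longrightarrow> disc_weight w \<noteq> 0"
  using disc_nonzero by (simp add: disc_weight_def)

lemma disc_weight_eq:
  assumes "norm w < 1"
  shows "w * cnj w * disc_weight w = disc_weight w - 1"
  using disc_nonzero[OF assms] by (simp add: disc_weight_def field_simps)

lemma jPQ_square:
  assumes "norm w < 1"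
  shows "rlin (jP w) (jQ w) (rlin (jP w) (jQ w) a) = - a"
proof -
  have "rlin (jP w) (jQ w) (rlin (jP w) (jQ w) a)
    = (4 * disc_weight w * (w * cnj w * disc_weight w) - (2 * disc_weight w - 1)\<^sup>2) * a"
    by (simp add: rlin_def jP_def jQ_def algebra_simps power2_eq_square)
  then show ?thesis
    unfolding disc_weight_eq[OF assms] by (simp add: algebra_simps power2_eq_square)
qed

text \<open>The inverse of the fibre coordinate. It is a quotient of affine functions of the complex structure
  and therefore differentiable.\<close>

lemma jP_recover:
  assumes "norm w < 1"
  shows "jP w + \<i> \<noteq> 0" "- jQ w / (jP w + \<i>) = w"
  using disc_weight_nonzero[OF assms] by (simp_all add: jP_def jQ_def algebra_simps)

lemma rlin_eqD:
  assumes "\<And>a. rlin p q a = rlin p' q' a"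
  shows "p = p'" "q = q'"
  using assms[of 1] assms[of "\<i>"] by (auto simp: rlin_def complex_eq_iff)

lemma rlin_add: "rlin p q (a + b) = rlin p q a + rlin p q b"
  and rlin_scale: "rlin p q (r *\<^sub>R a) = r *\<^sub>R rlin p q a"
  by (simp_all add: rlin_def algebra_simps scaleR_conv_of_real)

text \<open>Squaring to \<open>-1\<close> forces \<open>p = \<i> r\<close> with \<open>r\<close> real and \<open>r\<^sup>2 = 1 + norm q\<^sup>2\<close>. This is a hyperboloid of two sheets.
  Positivity selects the sheet \<open>r \<ge> 1\<close>, and the coordinate \<open>w\<close> is its stereographic projection onto
  the unit disc.\<close>

lemma compatible_structure_imp_disc:
  assumes sq: "\<And>a. rlin p q (rlin p q a) = - a"
    and pos: "\<And>a. a \<noteq> 0 \<Longrightarrow> Re (\<i> * a * cnj (rlin p q a)) > 0"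
  obtains w where "norm w < 1" "p = jP w" "q = jQ w"
proof -
  have "rlin (p * p + q * cnj q) (q * (p + cnj p)) a = rlin (-1) 0 a" for a
    using sq[of a] by (simp add: rlin_def algebra_simps)
  from rlin_eqD[OF this] have pq: "p * p + q * cnj q = -1" "q * (p + cnj p) = 0"
    by simp_all
  have qq: "q * cnj q = complex_of_real ((norm q)\<^sup>2)"
    by (rule complex_norm_square[symmetric])
  have "Re p = 0"
  proof (rule ccontr)
    assume r: "Re p \<noteq> 0"
    then have "p + cnj p \<noteq> 0"
      by (simp add: complex_eq_iff)
    with pq(2) have "q = 0"
      by simp
    with pq(1) have "Re p * Im p = 0" "Re p * Re p - Im p * Im p = -1"
      by (auto simp: complex_eq_iff)
    with r show False
      by (smt (verit) mult_eq_0_iff zero_le_square)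
  qed
  define r where "r = Im p"
  have p: "p = \<i> * complex_of_real r"
    using \<open>Re p = 0\<close> by (simp add: complex_eq_iff r_def)
  have "Re (p * p + q * cnj q) = -1"
    using pq(1) by simp
  then have r2: "r * r = 1 + (norm q)\<^sup>2"
    unfolding qq p by simp
  \<comment> \<open>In the sum over the orthogonal vectors \<open>1\<close> and \<open>\<i>\<close> the antilinear part cancels.\<close>
  have "Re (\<i> * 1 * cnj (rlin p q 1)) + Re (\<i> * \<i> * cnj (rlin p q \<i>)) = 2 * r"
    by (simp add: rlin_def p)
  then have "r > 0"
    using pos[of 1] pos[of "\<i>"] by simp
  have r1: "r \<ge> 1"
  proof (rule ccontr)
    assume "\<not> r \<ge> 1"
    then have "r * r < 1 * 1"
      using \<open>r > 0\<close> by (intro mult_strict_mono) auto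
    then show False
      using r2 by simp
  qed
  \<comment> \<open>The value prescribed by the inversion formula \<open>w = - q / (p + \<i>)\<close>.\<close>
  define w where "w = \<i> * q / complex_of_real (r + 1)"
  have nw: "(norm w)\<^sup>2 = (r - 1) / (r + 1)"
  proof -
    have "(norm w)\<^sup>2 = (r * r - 1) / (r + 1)\<^sup>2"
      using r1 r2 by (simp add: w_def norm_mult norm_divide power_divide del: of_real_add)
    also have "\<dots> = (r - 1) / (r + 1)"
    proof -
      have "r * r - 1 = (r - 1) * (r + 1)"
        by (simp add: algebra_simps)
      then show ?thesis
        using r1 by (simp add: power2_eq_square)
    qed
    finally show ?thesis .
  qed
  have "norm w < 1"
  proof -
    have "(norm w)\<^sup>2 < 1"
      using r1 by (simp add: nw)
    then show ?thesis
      by (simp add: abs_square_less_1)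
  qed
  have s: "disc_weight w = complex_of_real ((r + 1) / 2)"
    unfolding disc_weight_pos(1)[OF \<open>norm w < 1\<close>] nw using r1 by (simp add: field_simps)
  have "p = jP w"
    unfolding jP_def s p by (simp add: field_simps)
  moreover have "q = jQ w"
  proof -
    have "complex_of_real (r + 1) \<noteq> 0"
      using r1 by (simp only: of_real_eq_0_iff)
    then show ?thesis
      unfolding jQ_def s unfolding w_def of_real_divide by (simp del: of_real_add)
  qed
  ultimately show ?thesis
    using that \<open>norm w < 1\<close> by blast
qed

text \<open>The structure given by \<open>w\<close> preserves the area form, since its determinant is
  \<open>norm (jP w)\<^sup>2 - norm (jQ w)\<^sup>2 = 1\<close>. It tames the form because the form of \<open>a\<close> and its image
  is \<open>disc_weight w\<close> times the squared norm of \<open>a - w cnj a\<close>, which is nonzero for \<open>norm w < 1\<close>.\<close>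

lemma Re_area_jPQ:
  assumes "norm w < 1"
  shows "Re (\<i> * rlin (jP w) (jQ w) a * cnj (rlin (jP w) (jQ w) b)) = Re (\<i> * a * cnj b)"
    and "a \<noteq> 0 \<Longrightarrow> Re (\<i> * a * cnj (rlin (jP w) (jQ w) a)) > 0"
proof -
  define s where "s = inverse (1 - (norm w)\<^sup>2)"
  have s: "disc_weight w = complex_of_real s" "s > 0"
    using disc_weight_pos[OF assms] by (simp_all add: s_def)
  have e: "(Re w * Re w + Im w * Im w) * s = s - 1"
    using disc_weight_eq[OF assms] by (simp add: s complex_eq_iff)
  have P: "jP w = Complex 0 (2 * s - 1)" and Q: "jQ w = Complex (2 * s * Im w) (- 2 * s * Re w)"
    by (simp_all add: jP_def jQ_def s complex_eq_iff)
  have "Re (\<i> * rlin p q a * cnj (rlin p q b))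
      = (Re p * Re p + Im p * Im p - Re q * Re q - Im q * Im q) * Re (\<i> * a * cnj b)" for p q
    by (simp add: rlin_def algebra_simps)
  moreover have "Re (jP w) * Re (jP w) + Im (jP w) * Im (jP w) - Re (jQ w) * Re (jQ w) - Im (jQ w) * Im (jQ w)
      = (2 * s - 1) * (2 * s - 1) - 4 * s * ((Re w * Re w + Im w * Im w) * s)"
    by (simp add: P Q algebra_simps)
  moreover have "\<dots> = 1"
    unfolding e by (simp add: algebra_simps)
  ultimately show "Re (\<i> * rlin (jP w) (jQ w) a * cnj (rlin (jP w) (jQ w) b)) = Re (\<i> * a * cnj b)"
    by simp
  assume "a \<noteq> 0"
  \<comment> \<open>The antilinear map \<open>a \<mapsto> w cnj a\<close> shrinks norms, so it has no fixed vector except 0.\<close>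
  define m where "m = a - w * cnj a"
  have "m \<noteq> 0"
  proof
    assume "m = 0"
    then have "norm a = norm w * norm a"
      unfolding m_def by (metis complex_mod_cnj norm_mult right_minus_eq)
    then show False
      using assms \<open>a \<noteq> 0\<close> by simp
  qed
  have "Re (\<i> * a * cnj (rlin (jP w) (jQ w) a)) = s * (Re m * Re m + Im m * Im m)
     - (Re a * Re a + Im a * Im a) * ((Re w * Re w + Im w * Im w) * s - (s - 1))"
    by (simp add: P Q rlin_def m_def algebra_simps)
  then have "Re (\<i> * a * cnj (rlin (jP w) (jQ w) a)) = s * Re (m * cnj m)"
    unfolding e by simp
  then show "Re (\<i> * a * cnj (rlin (jP w) (jQ w) a)) > 0"
    unfolding Re_mult_cnj_self using \<open>m \<noteq> 0\<close> s by simp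
qed

text \<open>The argument is the real part of \<open>\<alpha>\<close> times the spanning vector of the eigenline, and the right-hand side
  is the negative of its imaginary part. This places the line inside the graph of \<open>-j\<close>, which is the eigenline.\<close>

lemma jPQ_eigen:
  assumes "norm w < 1"
  shows "rlin (jP w) (jQ w) ((\<alpha> + w * cnj \<alpha>) / 2) = \<i> * (\<alpha> - w * cnj \<alpha>) / 2"
proof -
  have "rlin (jP w) (jQ w) ((\<alpha> + w * cnj \<alpha>) / 2)
     = \<i> * ((2 * disc_weight w - 1 - 2 * (w * cnj w * disc_weight w)) * \<alpha> - w * cnj \<alpha>) / 2"
    by (simp add: rlin_def jP_def jQ_def field_simps)
  then show ?thesis
    unfolding disc_weight_eq[OF assms] by simp
qed

lemma disc_line_surj:
  assumes "norm w < 1"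
  obtains \<alpha> where "a = (\<alpha> + w * cnj \<alpha>) / 2"
proof
  have "2 * disc_weight w * (a - w * cnj a) + w * cnj (2 * disc_weight w * (a - w * cnj a))
      = 2 * (disc_weight w - w * cnj w * disc_weight w) * a"
    by (simp add: algebra_simps)
  then show "a = (2 * disc_weight w * (a - w * cnj a) + w * cnj (2 * disc_weight w * (a - w * cnj a))) / 2"
    unfolding disc_weight_eq[OF assms] by simp
qed

context conformal_surface
begin

abbreviation twistors :: "'a tpoint set" where
  "twistors \<equiv> twistor_space A (kaehler_form g)"

text \<open>An explicit form of the inverse of the bundle chart, which is characterised by an eigenline.
  The restriction to the tangent space is needed since points of the twistor space carry extensional
  functions.\<close>

definition chart_point :: "'a chart \<Rightarrow> complex \<Rightarrow> complex \<Rightarrow> 'a tpoint" where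
  "chart_point c z w = (cinv c z, \<lambda>u\<in>tangent_space A (cinv c z).
     coord_vec A c (rlin (jP w) (jQ w) (u c)) (cinv c z))"

lemma kaehler_formula:
  assumes "c \<in> A" "x \<in> cdom c" "u \<in> tangent_space A x" "v \<in> tangent_space A x"
  shows "kaehler_form g x u v = factor c (coord c x) * Re (\<i> * u c * cnj (v c))"
proof -
  have "rot u = coord_vec A c (\<i> * u c) x"
    using coord_vec_rot[of c "u c" x] assms by (simp add: coord_vec_of_comp)
  then have "rot u \<in> tangent_space A x"
    using coord_vec_in assms by simp
  then show ?thesis
    using metric_formula[OF assms(1,2), of "rot u" v] assms by (simp add: kaehler_form_def rot_def)
qed

lemma fst_chart_point: "fst (chart_point c z w) = cinv c z"
  by (simp add: chart_point_def)

lemma snd_chart_point: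
  "u \<in> tangent_space A (cinv c z) \<Longrightarrow>
   snd (chart_point c z w) u = coord_vec A c (rlin (jP w) (jQ w) (u c)) (cinv c z)"
  by (simp add: chart_point_def)

lemma chart_point_in:
  assumes "c \<in> A" "z \<in> cimg c" "norm w < 1"
  shows "chart_point c z w \<in> twistors"
proof -
  define x where "x = cinv c z"
  define T where "T = tangent_space A x"
  define j where "j = snd (chart_point c z w)"
  have x: "x \<in> cdom c"
    using assms cinv_in_cdom x_def by blast
  have j: "j u = coord_vec A c (rlin (jP w) (jQ w) (u c)) x" if "u \<in> T" for u
    using that by (simp add: j_def T_def x_def snd_chart_point)
  have jT: "j u \<in> T" if "u \<in> T" for u
    using coord_vec_in[OF assms(1) x] j[OF that] by (simp add: T_def)
  have jc: "j u c = rlin (jP w) (jQ w) (u c)" if "u \<in> T" for u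
    using coord_vec_self[OF assms(1) x] j[OF that] by simp
  have repr: "coord_vec A c (u c) x = u" if "u \<in> T" for u
    using coord_vec_of_comp[OF assms(1) x] that by (simp add: T_def)
  have T_add: "u +\<^sub>t v \<in> T" if "u \<in> T" "v \<in> T" for u v
    using tangent_add that unfolding T_def .
  have T_scale: "r *\<^sub>t u \<in> T" if "u \<in> T" for r u
    using tangent_scale that unfolding T_def .
  have "j \<in> T \<rightarrow>\<^sub>E T"
    using jT by (auto simp: j_def chart_point_def T_def x_def PiE_def extensional_def restrict_def)
  moreover have "fam_linear_on T j"
    unfolding fam_linear_on_def
    by (auto simp: T_add T_scale j rlin_add rlin_scale coord_vec_add coord_vec_scale)
  moreover have "j (j u) = (-1) *\<^sub>t u" if "u \<in> T" for u
  proof -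
    have "j (j u) = coord_vec A c (- u c) x"
      using j[OF jT[OF that]] jc[OF that] jPQ_square[OF assms(3)] by simp
    also have "\<dots> = (-1) *\<^sub>t u"
      using coord_vec_scale[of "-1" c "u c" x] repr[OF that] by simp
    finally show ?thesis .
  qed
  moreover have "kaehler_form g x (j u) (j v) = kaehler_form g x u v" if "u \<in> T" "v \<in> T" for u v
    using that jT kaehler_formula[OF assms(1) x] jc Re_area_jPQ(1)[OF assms(3)]
    by (simp add: T_def mult.assoc)
  moreover have "kaehler_form g x u (j u) > 0" if "u \<in> T" "u \<noteq> 0\<^sub>t" for u
  proof -
    have "u c \<noteq> 0"
      using that repr[OF that(1)] coord_vec_zero by metis
    then show ?thesis
      using kaehler_formula[OF assms(1) x, of u "j u"] that(1) jT[OF that(1)] jc[OF that(1)]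
        mult_pos_pos[OF factor_pos[OF assms(1) x] Re_area_jPQ(2)[OF assms(3)]]
      by (simp only: T_def)
  qed
  ultimately have "(x, j) \<in> twistors"
    by (simp add: twistor_space_def Let_def T_def)
  then show ?thesis
    by (simp add: x_def j_def chart_point_def)
qed

text \<open>In the chart the endomorphism is a real linear map of the plane, and the metric enters the conditions
  on it only through the positive conformal factor, so that the classification of compatible structures
  on the plane applies.\<close>

lemma chart_point_surj:
  assumes "c \<in> A" "p \<in> twistors" "fst p \<in> cdom c"
  obtains w where "norm w < 1" "p = chart_point c (coord c (fst p)) w"
proof -
  obtain x j where p: "p = (x, j)"
    by (cases p)
  define T where "T = tangent_space A x"
  have x: "x \<in> cdom c"
    using assms p by simp
  have j: "j \<in> T \<rightarrow>\<^sub>E T" "fam_linear_on T j" "\<And>u. u \<in> T \<Longrightarrow> j (j u) = (-1) *\<^sub>t u"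
      "\<And>u. u \<in> T \<Longrightarrow> u \<noteq> 0\<^sub>t \<Longrightarrow> kaehler_form g x u (j u) > 0"
    using assms(2) unfolding p twistor_space_def Let_def T_def by blast+
  have T: "coord_vec A c a x \<in> T" for a
    using coord_vec_in[OF assms(1) x] by (simp add: T_def)
  have jT: "j u \<in> T" if "u \<in> T" for u
    using j(1) that by auto
  have repr: "coord_vec A c (u c) x = u" if "u \<in> T" for u
    using coord_vec_of_comp[OF assms(1) x] that by (simp add: T_def)
  define L where "L a = j (coord_vec A c a x) c" for a
  have "linear L"
  proof (rule linearI)
    show "L (a + b) = L a + L b" for a b
      using j(2) T unfolding fam_linear_on_def L_def coord_vec_add[symmetric] by simp
    show "L (r *\<^sub>R a) = r *\<^sub>R L a" for r a
      using j(2) T unfolding fam_linear_on_def L_def coord_vec_scale[symmetric] by simp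
  qed
  define P Q where "P = (L 1 - \<i> * L \<i>) / 2" and "Q = (L 1 + \<i> * L \<i>) / 2"
  have L: "L a = rlin P Q a" for a
    unfolding rlin_def P_def Q_def by (rule real_linear_complex[OF \<open>linear L\<close>])
  have jL: "j u = coord_vec A c (rlin P Q (u c)) x" if "u \<in> T" for u
    using repr[OF jT[OF that]] L[of "u c"] repr[OF that] by (simp add: L_def)
  have sq: "rlin P Q (rlin P Q a) = - a" for a
  proof -
    have "rlin P Q (rlin P Q a) = j (j (coord_vec A c a x)) c"
      using jL[OF T] jL[OF jT[OF T]] by (simp add: coord_vec_self assms(1) x)
    then show ?thesis
      using j(3)[OF T] by (simp add: coord_vec_self assms(1) x)
  qed
  have pos: "Re (\<i> * a * cnj (rlin P Q a)) > 0" if "a \<noteq> 0" for a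
  proof -
    have "coord_vec A c a x \<noteq> 0\<^sub>t"
      using that coord_vec_self[OF assms(1) x, of a] by metis
    then have "kaehler_form g x (coord_vec A c a x) (j (coord_vec A c a x)) > 0"
      by (rule j(4)[OF T])
    then have "factor c (coord c x) * Re (\<i> * a * cnj (rlin P Q a)) > 0"
      using kaehler_formula[OF assms(1) x, of "coord_vec A c a x" "j (coord_vec A c a x)"] T jT[OF T]
        jL[OF T] by (simp only: T_def coord_vec_self[OF assms(1) x])
    then show ?thesis
      using factor_pos[OF assms(1) x] zero_less_mult_pos by blast
  qed
  obtain w where w: "norm w < 1" "P = jP w" "Q = jQ w"
    using compatible_structure_imp_disc[OF sq pos] by blast
  have "j = (\<lambda>u\<in>T. coord_vec A c (rlin P Q (u c)) x)"
    using j(1) jL by (intro ext) (auto simp: PiE_def extensional_def)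
  then have "p = chart_point c (coord c (fst p)) w"
    using x assms(1) by (simp add: chart_point_def p cinv_coord T_def w)
  with w that show ?thesis
    by blast
qed

text \<open>The eigenline is the graph of \<open>-j\<close>: on \<open>u + \<i> v\<close> the eigenvalue equation reads \<open>j u = - v\<close>, and
  its second half \<open>j v = u\<close> follows from \<open>j\<^sup>2 = -1\<close>.\<close>

lemma eigenline_eq:
  assumes "p \<in> twistors"
  shows "eigenline A p = (\<lambda>u. (u, (-1) *\<^sub>t snd p u)) ` tangent_space A (fst p)"
proof -
  obtain x j where p: "p = (x, j)"
    by (cases p)
  define T where "T = tangent_space A x"
  have j: "j \<in> T \<rightarrow>\<^sub>E T" "fam_linear_on T j" "\<And>u. u \<in> T \<Longrightarrow> j (j u) = (-1) *\<^sub>t u"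
    using assms unfolding p twistor_space_def Let_def T_def by blast+
  have jT: "j u \<in> T" if "u \<in> T" for u
    using j(1) that by auto
  have neg: "j ((-1) *\<^sub>t j u) = u" if "u \<in> T" for u
  proof -
    have "j ((-1) *\<^sub>t j u) = (-1) *\<^sub>t j (j u)"
      using j(2) jT[OF that] unfolding fam_linear_on_def by blast
    then show ?thesis
      using j(3)[OF that] by simp
  qed
  have nT: "(-1) *\<^sub>t j u \<in> T" if "u \<in> T" for u
    using tangent_scale jT[OF that] unfolding T_def .
  have "(j u, j v) = ct_scale \<i> (u, v) \<longleftrightarrow> v = (-1) *\<^sub>t j u" if "u \<in> T" "v \<in> T" for u v
  proof -
    have "ct_scale \<i> (u, v) = ((-1) *\<^sub>t v, u)"
      by (simp add: ct_scale_def)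
    moreover have "j u = (-1) *\<^sub>t v \<longleftrightarrow> v = (-1) *\<^sub>t j u"
      by (auto simp: fun_eq_iff)
    ultimately show ?thesis
      using neg[OF that(1)] by auto
  qed
  then show ?thesis
    using nT by (auto simp: eigenline_def p T_def[symmetric])
qed

lemma eigenline_inj:
  assumes "p \<in> twistors" "q \<in> twistors" "fst p = fst q" "eigenline A p = eigenline A q"
  shows "p = q"
proof -
  define T where "T = tangent_space A (fst p)"
  have "snd p \<in> extensional T" "snd q \<in> extensional T"
    using assms(1-3) by (auto simp: twistor_space_def Let_def T_def PiE_def)
  moreover have "snd p u = snd q u" if "u \<in> T" for u
  proof -
    have "(u, (-1) *\<^sub>t snd p u) \<in> eigenline A q"
      using that assms eigenline_eq[OF assms(1)] by (auto simp: T_def)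
    then have "(-1) *\<^sub>t snd p u = (-1) *\<^sub>t snd q u"
      unfolding eigenline_eq[OF assms(2)] by auto
    then show ?thesis
      by (simp add: fun_eq_iff)
  qed
  ultimately have "snd p = snd q"
    by (rule extensionalityI)
  with assms(3) show ?thesis
    by (simp add: prod_eq_iff)
qed

lemma eigenline_chart_point:
  assumes "c \<in> A" "z \<in> cimg c" "norm w < 1"
  shows "eigenline A (chart_point c z w) = range (\<lambda>a. ct_scale a
      (ct_add (partial_z A c (cinv c z)) (ct_scale (cnj w) (partial_zbar A c (cinv c z)))))"
proof -
  define x where "x = cinv c z"
  have x: "x \<in> cdom c"
    using assms cinv_in_cdom x_def by blast
  define l where "l \<alpha> = (coord_vec A c ((\<alpha> + w * cnj \<alpha>) / 2) x,
      coord_vec A c (- \<i> * (\<alpha> - w * cnj \<alpha>) / 2) x)" for \<alpha>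
  have "ct_scale a (ct_add (partial_z A c x) (ct_scale (cnj w) (partial_zbar A c x))) = l a" for a
    by (simp add: ct_scale_def ct_add_def partial_z_def partial_zbar_def l_def fun_eq_iff coord_vec_def)
      (simp add: complex_eq_iff field_simps)
  moreover have "eigenline A (chart_point c z w) = range l"
  proof -
    have l: "l \<alpha> = (u, (-1) *\<^sub>t snd (chart_point c z w) u)"
      if "u \<in> tangent_space A x" "u c = (\<alpha> + w * cnj \<alpha>) / 2" for \<alpha> u
    proof -
      have "u = coord_vec A c ((\<alpha> + w * cnj \<alpha>) / 2) x"
        using coord_vec_of_comp[OF assms(1) x that(1)] that(2) by simp
      moreover have "snd (chart_point c z w) u = coord_vec A c (\<i> * (\<alpha> - w * cnj \<alpha>) / 2) x"
        using snd_chart_point[of u c z w] that(1)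
        unfolding that(2) jPQ_eigen[OF assms(3)] x_def by blast
      ultimately show ?thesis
        using coord_vec_scale[of "-1" c "\<i> * (\<alpha> - w * cnj \<alpha>) / 2" x] by (simp add: l_def)
    qed
    have "range l = (\<lambda>u. (u, (-1) *\<^sub>t snd (chart_point c z w) u)) ` tangent_space A x"
    proof (intro equalityI subsetI)
      fix y assume "y \<in> range l"
      then obtain \<alpha> where "y = l \<alpha>"
        by blast
      then show "y \<in> (\<lambda>u. (u, (-1) *\<^sub>t snd (chart_point c z w) u)) ` tangent_space A x"
        using l[of "coord_vec A c ((\<alpha> + w * cnj \<alpha>) / 2) x" \<alpha>] coord_vec_in[OF assms(1) x]
          coord_vec_self[OF assms(1) x] by (intro image_eqI) auto
    next
      fix y assume "y \<in> (\<lambda>u. (u, (-1) *\<^sub>t snd (chart_point c z w) u)) ` tangent_space A x"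
      then obtain u where u: "u \<in> tangent_space A x" "y = (u, (-1) *\<^sub>t snd (chart_point c z w) u)"
        by blast
      obtain \<alpha> where "u c = (\<alpha> + w * cnj \<alpha>) / 2"
        using disc_line_surj[OF assms(3)] by blast
      then show "y \<in> range l"
        using l[OF u(1)] u(2) by (metis rangeI)
    qed
    then show ?thesis
      unfolding eigenline_eq[OF chart_point_in[OF assms]] fst_chart_point x_def by simp
  qed
  ultimately show ?thesis
    by (simp add: x_def)
qed

lemma twistor_point_eq:
  assumes "c \<in> A" "z \<in> cimg c" "norm w < 1"
  shows "twistor_point A (kaehler_form g) c z w = chart_point c z w"
  unfolding twistor_point_def
proof (rule the_equality)
  show "chart_point c z w \<in> twistors \<and> fst (chart_point c z w) = cinv c z \<and>
      eigenline A (chart_point c z w) = range (\<lambda>a. ct_scale a (ct_add (partial_z A c (fst (chart_point c z w)))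
        (ct_scale (cnj w) (partial_zbar A c (fst (chart_point c z w))))))"
    using chart_point_in[OF assms] eigenline_chart_point[OF assms] by (simp add: fst_chart_point)
next
  fix p assume "p \<in> twistors \<and> fst p = cinv c z \<and>
      eigenline A p = range (\<lambda>a. ct_scale a (ct_add (partial_z A c (fst p))
        (ct_scale (cnj w) (partial_zbar A c (fst p)))))"
  then show "p = chart_point c z w"
    using eigenline_inj[of p "chart_point c z w"] chart_point_in[OF assms] eigenline_chart_point[OF assms]
    by (simp add: fst_chart_point)
qed

end

section \<open>Tangent vectors of the twistor space\<close>

lemma bounded_linear_rlin: "bounded_linear (rlin p q)"
  unfolding linear_conv_bounded_linear[symmetric]
  by (rule linearI) (simp_all add: rlin_def algebra_simps scaleR_conv_of_real)

definition rblin :: "complex \<Rightarrow> complex \<Rightarrow> complex \<Rightarrow>\<^sub>L complex" where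
  "rblin p q = Blinfun (rlin p q)"

lemma rblin_apply: "blinfun_apply (rblin p q) a = rlin p q a"
  by (simp add: rblin_def bounded_linear_Blinfun_apply bounded_linear_rlin)

lemma rblin_add: "rblin p q + rblin p' q' = rblin (p + p') (q + q')"
  by (rule blinfun_eqI) (simp add: rblin_apply blinfun.add_left rlin_def algebra_simps)

lemma rblin_scale: "r *\<^sub>R rblin p q = rblin (r *\<^sub>R p) (r *\<^sub>R q)"
  by (rule blinfun_eqI) (simp add: rblin_apply blinfun.scaleR_left rlin_def algebra_simps)

lemma bounded_linear_rblin: "bounded_linear (\<lambda>y. rblin (fst y) (snd y))"
  unfolding linear_conv_bounded_linear[symmetric]
  by (rule linearI) (simp_all add: rblin_add rblin_scale)

definition hol_part :: "(complex \<Rightarrow>\<^sub>L complex) \<Rightarrow> complex" where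
  "hol_part B = (blinfun_apply B 1 - \<i> * blinfun_apply B \<i>) / 2"

definition antihol_part :: "(complex \<Rightarrow>\<^sub>L complex) \<Rightarrow> complex" where
  "antihol_part B = (blinfun_apply B 1 + \<i> * blinfun_apply B \<i>) / 2"

lemma hol_part_rblin [simp]: "hol_part (rblin p q) = p"
  and antihol_part_rblin [simp]: "antihol_part (rblin p q) = q"
  by (simp_all add: hol_part_def antihol_part_def rblin_apply rlin_def algebra_simps)

lemma hol_part_has_derivative [derivative_intros]:
  "(F has_derivative F') (at x) \<Longrightarrow> ((\<lambda>x. hol_part (F x)) has_derivative (\<lambda>h. hol_part (F' h))) (at x)"
  unfolding hol_part_def by (auto intro!: derivative_eq_intros)

lemma antihol_part_has_derivative [derivative_intros]:
  "(F has_derivative F') (at x) \<Longrightarrow> ((\<lambda>x. antihol_part (F x)) has_derivative (\<lambda>h. antihol_part (F' h))) (at x)"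
  unfolding antihol_part_def by (auto intro!: derivative_eq_intros)

text \<open>The derivatives of \<open>disc_weight\<close>, \<open>jP\<close> and \<open>jQ\<close> at \<open>w\<close> in the direction \<open>\<eta>\<close>.\<close>

definition d_disc_weight :: "complex \<Rightarrow> complex \<Rightarrow> complex" where
  "d_disc_weight w \<eta> = (disc_weight w)\<^sup>2 * (w * cnj \<eta> + \<eta> * cnj w)"

definition djP :: "complex \<Rightarrow> complex \<Rightarrow> complex" where
  "djP w \<eta> = 2 * \<i> * d_disc_weight w \<eta>"

definition djQ :: "complex \<Rightarrow> complex \<Rightarrow> complex" where
  "djQ w \<eta> = - 2 * \<i> * (\<eta> * disc_weight w + w * d_disc_weight w \<eta>)"

lemma disc_weight_has_derivative:
  assumes "norm w < 1"
  shows "(disc_weight has_derivative d_disc_weight w) (at w)"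
proof -
  have "((\<lambda>w. 1 - w * cnj w) has_derivative (\<lambda>\<eta>. 0 - (w * cnj \<eta> + \<eta> * cnj w))) (at w)"
    by (intro has_derivative_diff has_derivative_mult has_derivative_cnj has_derivative_ident
        has_derivative_const)
  from Deriv.has_derivative_inverse[OF disc_nonzero[OF assms] this]
  have "((\<lambda>w. inverse (1 - w * cnj w)) has_derivative (\<lambda>\<eta>. - (inverse (1 - w * cnj w)
      * (0 - (w * cnj \<eta> + \<eta> * cnj w)) * inverse (1 - w * cnj w)))) (at w)" .
  moreover have "(\<lambda>\<eta>. - (inverse (1 - w * cnj w) * (0 - (w * cnj \<eta> + \<eta> * cnj w))
      * inverse (1 - w * cnj w))) = d_disc_weight w"
    unfolding disc_weight_def[symmetric] by (simp add: fun_eq_iff d_disc_weight_def power2_eq_square algebra_simps)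
  moreover have "(\<lambda>w. inverse (1 - w * cnj w)) = disc_weight"
    by (simp add: fun_eq_iff disc_weight_def)
  ultimately show ?thesis
    by (simp only:)
qed

lemma jP_has_derivative:
  assumes "norm w < 1"
  shows "(jP has_derivative djP w) (at w)"
proof -
  have "((\<lambda>w. \<i> * (2 * disc_weight w - 1)) has_derivative (\<lambda>\<eta>. \<i> * (2 * d_disc_weight w \<eta> - 0))) (at w)"
    by (intro has_derivative_mult_right has_derivative_diff has_derivative_const
        disc_weight_has_derivative assms)
  then show ?thesis
    by (simp add: jP_def[abs_def] djP_def[abs_def] mult.assoc mult.left_commute)
qed

lemma jQ_has_derivative:
  assumes "norm w < 1"
  shows "(jQ has_derivative djQ w) (at w)"
proof -
  have "((\<lambda>w. - 2 * \<i> * (w * disc_weight w)) has_derivative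
      (\<lambda>\<eta>. - 2 * \<i> * (w * d_disc_weight w \<eta> + \<eta> * disc_weight w))) (at w)"
    by (intro has_derivative_mult_right has_derivative_mult has_derivative_ident
        disc_weight_has_derivative assms)
  then show ?thesis
    by (simp add: jQ_def[abs_def] djQ_def[abs_def] mult.assoc add.commute)
qed

text \<open>The coordinates \<open>(z, w)\<close> of a point, as a function of its coordinates in the total space of the
  endomorphism bundle. As a quotient of affine functions it turns the differentiability of a curve of
  endomorphisms into the differentiability of its coordinates \<open>(z, w)\<close>.\<close>

definition tw_coords :: "complex \<times> (complex \<Rightarrow>\<^sub>L complex) \<Rightarrow> complex \<times> complex" where
  "tw_coords y = (fst y, - antihol_part (snd y) / (hol_part (snd y) + \<i>))"

lemma tw_coords_rblin: "norm w < 1 \<Longrightarrow> tw_coords (z, rblin (jP w) (jQ w)) = (z, w)"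
  using jP_recover[of w] by (simp add: tw_coords_def)

lemma tw_coords_differentiable:
  assumes "norm w < 1"
  obtains K where "(tw_coords has_derivative K) (at (z, rblin (jP w) (jQ w)))"
proof -
  have "\<exists>K. ((\<lambda>y. (fst y, - antihol_part (snd y) / (hol_part (snd y) + \<i>))) has_derivative K)
      (at (z, rblin (jP w) (jQ w)))"
    by (rule exI) (auto intro!: derivative_eq_intros simp: jP_recover(1)[OF assms])
  then show ?thesis
    using that by (auto simp: tw_coords_def[abs_def])
qed

lemma chain_along_curve:
  assumes y: "(y has_vector_derivative \<eta>) (at 0)" "y 0 = a"
    and G: "(G has_derivative L) (at a)"
    and eq: "eventually (\<lambda>t::real. H t = G (y t)) (nhds 0)"
  shows "(H has_vector_derivative L \<eta>) (at 0)"
proof -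
  have "((\<lambda>t. G (y t)) has_derivative (\<lambda>t. L (t *\<^sub>R \<eta>))) (at 0)"
    using has_derivative_compose[of y "\<lambda>t. t *\<^sub>R \<eta>" 0 UNIV G L] y G
    by (simp add: has_vector_derivative_def)
  moreover have "L (t *\<^sub>R \<eta>) = t *\<^sub>R L \<eta>" for t
    using has_derivative_linear[OF G] by (rule linear_scale)
  ultimately have "((\<lambda>t. G (y t)) has_derivative (\<lambda>t. t *\<^sub>R L \<eta>)) (at 0)"
    by simp
  then have "(H has_derivative (\<lambda>t. t *\<^sub>R L \<eta>)) (at 0)"
    by (rule has_derivative_transform_eventually)
       (use eq eventually_nhds_x_imp_x[OF eq] in \<open>auto simp: eventually_at_filter elim!: eventually_mono\<close>)
  then show ?thesis
    by (simp add: has_vector_derivative_def)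
qed

context conformal_surface
begin

text \<open>Conjugation by multiplication with the derivative \<open>u\<close> of the transition map fixes the complex linear part and
  multiplies the antilinear part by \<open>u / cnj u\<close>.\<close>

lemma snd_chart_point_other_chart:
  assumes "c \<in> A" "d \<in> A" "z \<in> overlap c d"
  shows "snd (chart_point c z w) (coord_vec A d a (cinv c z)) d
    = rlin (jP w) (jac c d z / cnj (jac c d z) * jQ w) a"
proof -
  obtain x where x: "z = coord c x" "x \<in> cdom c" "x \<in> cdom d"
    using assms(3) by blast
  have cx: "cinv c z = x"
    using x assms by (simp add: cinv_coord)
  have u: "jac c d z \<noteq> 0"
    using jac_nonzero assms x by simp
  have inv: "jac d c (coord d x) = inverse (jac c d z)"
    using jac_cocycle[of c d c x] jac_refl[OF assms(1), of z] assms x u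
    by (simp add: coord_in_cimg field_simps)
  have "snd (chart_point c z w) (coord_vec A d a x)
      = coord_vec A c (rlin (jP w) (jQ w) (inverse (jac c d z) * a)) x"
    using snd_chart_point[of "coord_vec A d a x" c z w] coord_vec_in[OF assms(2) x(3)]
      coord_vec_comp[OF assms(1) x(2)] by (simp add: cx inv)
  then have "snd (chart_point c z w) (coord_vec A d a x) d
      = jac c d z * rlin (jP w) (jQ w) (inverse (jac c d z) * a)"
    using coord_vec_comp[OF assms(2) x(3)] x(1) by simp
  also have "\<dots> = rlin (jP w) (jac c d z / cnj (jac c d z) * jQ w) a"
    using u by (simp add: rlin_def field_simps)
  finally show ?thesis
    by (simp add: cx)
qed

lemma tw_rep_chart_point:
  assumes "c \<in> A" "d \<in> A" "z \<in> overlap c d"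
  shows "tw_rep A d (chart_point c z w)
    = (transition c d z, rblin (jP w) (jac c d z / cnj (jac c d z) * jQ w))"
  using snd_chart_point_other_chart[OF assms] by (simp add: tw_rep_def fst_chart_point rblin_def transition_def)

lemma tw_rep_chart_point_self:
  assumes "c \<in> A" "z \<in> cimg c"
  shows "tw_rep A c (chart_point c z w) = (z, rblin (jP w) (jQ w))"
proof -
  have "z \<in> overlap c c"
    using assms overlap_iff cinv_in_cdom by blast
  moreover have "transition c c z = z"
    using assms by (simp add: transition_def coord_cinv)
  ultimately show ?thesis
    using tw_rep_chart_point[OF assms(1,1)] jac_refl[OF assms] by simp
qed

text \<open>The tangent vector at the point \<open>(z, w)\<close> with components \<open>(v, \<eta>)\<close> in the bundle chart. Its component in a
  chart \<open>d\<close> is the derivative of the representation of the point in \<open>d\<close>. The summand with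
  \<open>deriv (jac c d) z\<close> comes from the dependence of \<open>jac c d z / cnj (jac c d z)\<close> on \<open>z\<close>.\<close>

definition coord_ttvec :: "'a chart \<Rightarrow> complex \<Rightarrow> complex \<Rightarrow> complex \<Rightarrow> complex \<Rightarrow> 'a ttvec" where
  "coord_ttvec c z w v \<eta> = (\<lambda>d. if d \<in> charts_at A (cinv c z)
     then (jac c d z * v,
       rblin (djP w \<eta>) (jac c d z / cnj (jac c d z) * (djQ w \<eta>
         + jQ w * (deriv (jac c d) z / jac c d z * v - cnj (deriv (jac c d) z / jac c d z * v)))))
     else 0)"

lemma tw_rep_chart_point_has_derivative:
  assumes "c \<in> A" "d \<in> A" "z \<in> overlap c d" "norm w < 1"
  shows "((\<lambda>y. tw_rep A d (chart_point c (fst y) (snd y))) has_derivative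
    (\<lambda>h. coord_ttvec c z w (fst h) (snd h) d)) (at (z, w))"
proof -
  define u k where "u = jac c d z" and "k = deriv (jac c d) z"
  have u0: "u \<noteq> 0"
    using jac_nonzero[OF assms(1,2)] assms(3) by (auto simp: u_def)
  have z: "cinv c z \<in> cdom c" "cinv c z \<in> cdom d"
    using assms by (auto simp: cinv_coord)
  have fst': "(fst has_derivative fst) (at (z, w))" and snd': "(snd has_derivative snd) (at (z, w))"
    by (auto intro!: derivative_eq_intros)
  have T: "((\<lambda>y. transition c d (fst y)) has_derivative (\<lambda>h. u * fst h)) (at (z, w))"
    using has_derivative_compose[OF fst', of "transition c d" "(*) u"]
      transition_has_derivative[OF assms(1-3)] by (simp add: has_field_derivative_def u_def)
  have U: "((\<lambda>y. jac c d (fst y)) has_derivative (\<lambda>h. k * fst h)) (at (z, w))"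
    using has_derivative_compose[OF fst', of "jac c d" "(*) k"]
      jac_has_derivative[OF assms(1-3)] by (simp add: has_field_derivative_def k_def)
  have P: "((\<lambda>y. jP (snd y)) has_derivative (\<lambda>h. djP w (snd h))) (at (z, w))"
    using has_derivative_compose[OF snd', of jP "djP w"] jP_has_derivative[OF assms(4)] by simp
  have Q: "((\<lambda>y. jQ (snd y)) has_derivative (\<lambda>h. djQ w (snd h))) (at (z, w))"
    using has_derivative_compose[OF snd', of jQ "djQ w"] jQ_has_derivative[OF assms(4)] by simp
  have UU: "((\<lambda>y. jac c d (fst y) / cnj (jac c d (fst y))) has_derivative
      (\<lambda>h. (k * fst h * cnj u - u * cnj (k * fst h)) / (cnj u * cnj u))) (at (z, w))"
    using has_derivative_divide'[OF U has_derivative_cnj[OF U]] u0 by (simp add: u_def)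
  have UQ: "((\<lambda>y. jac c d (fst y) / cnj (jac c d (fst y)) * jQ (snd y)) has_derivative
      (\<lambda>h. u / cnj u * djQ w (snd h)
        + (k * fst h * cnj u - u * cnj (k * fst h)) / (cnj u * cnj u) * jQ w)) (at (z, w))"
    using has_derivative_mult[OF UU Q] by (simp add: u_def)
  have "((\<lambda>y. (transition c d (fst y),
        rblin (jP (snd y)) (jac c d (fst y) / cnj (jac c d (fst y)) * jQ (snd y)))) has_derivative
      (\<lambda>h. (u * fst h, rblin (djP w (snd h)) (u / cnj u * djQ w (snd h)
        + (k * fst h * cnj u - u * cnj (k * fst h)) / (cnj u * cnj u) * jQ w)))) (at (z, w))"
    using has_derivative_Pair[OF T bounded_linear.has_derivative[OF bounded_linear_rblin
      has_derivative_Pair[OF P UQ]]] by simp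
  moreover have "u / cnj u * djQ w (snd h)
        + (k * fst h * cnj u - u * cnj (k * fst h)) / (cnj u * cnj u) * jQ w
      = u / cnj u * (djQ w (snd h) + jQ w * (k / u * fst h - cnj (k / u * fst h)))" for h
    using u0 by (simp add: field_simps)
  ultimately have "((\<lambda>y. (transition c d (fst y),
        rblin (jP (snd y)) (jac c d (fst y) / cnj (jac c d (fst y)) * jQ (snd y)))) has_derivative
      (\<lambda>h. coord_ttvec c z w (fst h) (snd h) d)) (at (z, w))"
    using z assms(2) by (simp add: coord_ttvec_def charts_at_def u_def k_def)
  then show ?thesis
    by (rule has_derivative_transform_within_open[OF _ open_Times[OF open_overlap[OF assms(1,2)] open_UNIV]])
       (use assms tw_rep_chart_point[OF assms(1,2)] in auto)
qed

definition bundle_chart_image :: "'a chart \<Rightarrow> (complex \<times> complex) set" where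
  "bundle_chart_image c = cimg c \<times> ball 0 1"

lemma open_bundle_chart_image: "c \<in> A \<Longrightarrow> open (bundle_chart_image c)"
  by (simp add: bundle_chart_image_def open_Times open_cimg)

lemma tw_coords_derivative_coord_ttvec:
  assumes "c \<in> A" "z \<in> cimg c" "norm w < 1"
  obtains K where "(tw_coords has_derivative K) (at (tw_rep A c (chart_point c z w)))"
    "\<And>v \<eta>. K (coord_ttvec c z w v \<eta> c) = (v, \<eta>)"
proof -
  obtain K where K: "(tw_coords has_derivative K) (at (tw_rep A c (chart_point c z w)))"
    using tw_coords_differentiable[OF assms(3)] tw_rep_chart_point_self[OF assms(1,2)] by metis
  have z: "z \<in> overlap c c"
    using assms overlap_iff cinv_in_cdom by blast
  have "((\<lambda>y. tw_coords (tw_rep A c (chart_point c (fst y) (snd y)))) has_derivative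
      (\<lambda>h. K (coord_ttvec c z w (fst h) (snd h) c))) (at (z, w))"
    using has_derivative_compose[OF tw_rep_chart_point_has_derivative[OF assms(1,1) z assms(3)]] K by simp
  \<comment> \<open>The composition is the identity near \<open>(z, w)\<close>, and derivatives are unique.\<close>
  then have "((\<lambda>y. y) has_derivative (\<lambda>h. K (coord_ttvec c z w (fst h) (snd h) c))) (at (z, w))"
    by (rule has_derivative_transform_within_open[OF _ open_bundle_chart_image[OF assms(1)]])
       (use assms in \<open>auto simp: bundle_chart_image_def tw_rep_chart_point_self tw_coords_rblin\<close>)
  from has_derivative_unique[OF this has_derivative_ident]
  have "K (coord_ttvec c z w (fst h) (snd h) c) = h" for h
    by (simp add: fun_eq_iff)
  from this[of "(_, _)"] that[OF K] show ?thesis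
    by simp
qed

lemma coord_ttvec_inj:
  assumes "c \<in> A" "z \<in> cimg c" "norm w < 1" "coord_ttvec c z w v \<eta> c = coord_ttvec c z w v' \<eta>' c"
  shows "v = v'" "\<eta> = \<eta>'"
  using tw_coords_derivative_coord_ttvec[OF assms(1-3)] assms(4) by (metis prod.inject)+

lemma coord_ttvec_add: "coord_ttvec c z w v \<eta> +\<^sub>t coord_ttvec c z w v' \<eta>' = coord_ttvec c z w (v + v') (\<eta> + \<eta>')"
proof
  fix d
  have "djP w \<eta> + djP w \<eta>' = djP w (\<eta> + \<eta>')" "djQ w \<eta> + djQ w \<eta>' = djQ w (\<eta> + \<eta>')"
    by (simp_all add: djP_def djQ_def d_disc_weight_def algebra_simps)
  note djPQ_add = this[symmetric]
  have "K * (djQ w \<eta> + jQ w * (\<theta> * v - cnj (\<theta> * v))) + K * (djQ w \<eta>' + jQ w * (\<theta> * v' - cnj (\<theta> * v')))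
      = K * (djQ w (\<eta> + \<eta>') + jQ w * (\<theta> * (v + v') - cnj (\<theta> * (v + v'))))" for K \<theta>
    by (simp add: djPQ_add algebra_simps)
  then show "coord_ttvec c z w v \<eta> d + coord_ttvec c z w v' \<eta>' d = coord_ttvec c z w (v + v') (\<eta> + \<eta>') d"
    unfolding coord_ttvec_def by (simp only: rblin_add djPQ_add(1) if_distrib add_Pair distrib_left[of "jac c d z"] split: if_split) simp
qed

text \<open>Continuity of the base point keeps the curve inside the chart for small times, where its
  coordinates \<open>(z, w)\<close> are differentiable functions. Everything about the curve, in particular its
  velocity in the other charts, then follows from the chain rule.\<close>

lemma velocity_coords:
  assumes "c \<in> A" "z \<in> cimg c" "norm w < 1" "has_velocity A twistors \<gamma> (chart_point c z w) \<xi>"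
  obtains y v \<eta> where "(y has_vector_derivative (v, \<eta>)) (at 0)" "y 0 = (z, w)"
    "eventually (\<lambda>t. \<gamma> t = chart_point c (fst (y t)) (snd (y t))) (nhds 0)" "\<xi> = coord_ttvec c z w v \<eta>"
proof -
  obtain K where K: "(tw_coords has_derivative K) (at (tw_rep A c (chart_point c z w)))"
    "\<And>v \<eta>. K (coord_ttvec c z w v \<eta> c) = (v, \<eta>)"
    using tw_coords_derivative_coord_ttvec[OF assms(1-3)] by blast
  have x: "cinv c z \<in> cdom c"
    using assms cinv_in_cdom by blast
  have g0: "\<gamma> 0 = chart_point c z w" and gZ: "\<And>t. \<gamma> t \<in> twistors" and cont: "isCont (fst \<circ> \<gamma>) 0"
    and vel: "\<And>d. d \<in> charts_at A (cinv c z) \<Longrightarrow> ((tw_rep A d \<circ> \<gamma>) has_vector_derivative \<xi> d) (at 0)"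
    and zero: "\<And>d. d \<notin> charts_at A (cinv c z) \<Longrightarrow> \<xi> d = 0"
    using assms(4) by (auto simp: has_velocity_def fst_chart_point)
  define y where "y = tw_coords \<circ> tw_rep A c \<circ> \<gamma>"
  have c: "c \<in> charts_at A (cinv c z)"
    using assms(1) x by (simp add: charts_at_def)
  have y: "(y has_vector_derivative K (\<xi> c)) (at 0)"
    unfolding y_def comp_assoc
    by (rule chain_along_curve[OF vel[OF c] _ K(1)]) (simp_all add: g0)
  have y0: "y 0 = (z, w)"
    using assms by (simp add: y_def g0 tw_rep_chart_point_self tw_coords_rblin)
  have eq: "\<gamma> t = chart_point c (fst (y t)) (snd (y t))" if t: "fst (\<gamma> t) \<in> cdom c" for t
  proof -
    obtain w' where "norm w' < 1" "\<gamma> t = chart_point c (coord c (fst (\<gamma> t))) w'"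
      using chart_point_surj[OF assms(1) gZ t] by blast
    moreover have "coord c (fst (\<gamma> t)) \<in> cimg c"
      using coord_in_cimg[OF assms(1) t] .
    ultimately have "y t = (coord c (fst (\<gamma> t)), w')"
      using tw_rep_chart_point_self[OF assms(1)] tw_coords_rblin unfolding y_def o_def by metis
    with \<open>\<gamma> t = _\<close> show ?thesis
      by simp
  qed
  have "eventually (\<lambda>t. (fst \<circ> \<gamma>) t \<in> cdom c) (nhds 0)"
    using topological_tendstoD[OF cont[unfolded isCont_def] open_cdom[OF assms(1)]] x
    by (simp add: eventually_nhds_conv_at g0 fst_chart_point)
  then have ev: "eventually (\<lambda>t. \<gamma> t = chart_point c (fst (y t)) (snd (y t))) (nhds 0)"
    by (rule eventually_mono) (use eq in simp)
  obtain v \<eta> where v: "K (\<xi> c) = (v, \<eta>)"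
    by (cases "K (\<xi> c)")
  have "\<xi> d = coord_ttvec c z w v \<eta> d" for d
  proof (cases "d \<in> charts_at A (cinv c z)")
    case True
    have "z \<in> overlap c d" "d \<in> A"
      using True assms by (auto simp: charts_at_def overlap_iff)
    moreover have "eventually (\<lambda>t. (tw_rep A d \<circ> \<gamma>) t = tw_rep A d (chart_point c (fst (y t)) (snd (y t)))) (nhds 0)"
      using ev by (rule eventually_mono) simp
    ultimately have "((tw_rep A d \<circ> \<gamma>) has_vector_derivative coord_ttvec c z w v \<eta> d) (at 0)"
      using chain_along_curve[OF y[unfolded v] y0 tw_rep_chart_point_has_derivative[OF assms(1) _ _ assms(3)]]
      by fastforce
    then show ?thesis
      using vel[OF True] vector_derivative_unique_at by blast
  qed (simp add: zero coord_ttvec_def)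
  then have "\<xi> = coord_ttvec c z w v \<eta>"
    by blast
  then show ?thesis
    by (rule that[OF y[unfolded v] y0 ev])
qed

text \<open>The straight line in the coordinates \<open>(z, w)\<close> has the required velocity. Once it leaves the
  chart it is replaced by a constant, because a curve has to be defined for all times.\<close>

lemma coord_ttvec_is_velocity:
  assumes "c \<in> A" "z \<in> cimg c" "norm w < 1"
  shows "\<exists>\<gamma>. has_velocity A twistors \<gamma> (chart_point c z w) (coord_ttvec c z w v \<eta>)"
proof -
  define y where "y t = (z + t *\<^sub>R v, w + t *\<^sub>R \<eta>)" for t :: real
  define \<gamma> where "\<gamma> t = (if y t \<in> bundle_chart_image c then chart_point c (fst (y t)) (snd (y t))
    else chart_point c z w)" for t
  have y: "(y has_vector_derivative (v, \<eta>)) (at 0)" "y 0 = (z, w)"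
    unfolding y_def[abs_def] has_vector_derivative_def by (auto intro!: derivative_eq_intros)
  have x: "cinv c z \<in> cdom c"
    using assms cinv_in_cdom by blast
  have yc: "isCont y 0"
    using y(1) has_vector_derivative_continuous by blast
  have "(z, w) \<in> bundle_chart_image c"
    using assms by (simp add: bundle_chart_image_def)
  then have "eventually (\<lambda>t. y t \<in> bundle_chart_image c) (nhds 0)"
    using topological_tendstoD[OF yc[unfolded isCont_def] open_bundle_chart_image[OF assms(1)]] y(2)
    by (simp add: eventually_nhds_conv_at)
  then have ev: "eventually (\<lambda>t. \<gamma> t = chart_point c (fst (y t)) (snd (y t))) (nhds 0)"
    by (rule eventually_mono) (simp add: \<gamma>_def)
  have "((tw_rep A d \<circ> \<gamma>) has_vector_derivative coord_ttvec c z w v \<eta> d) (at 0)"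
    if "d \<in> charts_at A (cinv c z)" for d
  proof -
    have d: "d \<in> A" "z \<in> overlap c d"
      using that assms by (auto simp: charts_at_def overlap_iff)
    have "eventually (\<lambda>t. (tw_rep A d \<circ> \<gamma>) t = tw_rep A d (chart_point c (fst (y t)) (snd (y t)))) (nhds 0)"
      using ev by (rule eventually_mono) simp
    from chain_along_curve[OF y tw_rep_chart_point_has_derivative[OF assms(1) d assms(3)] this]
    show ?thesis
      by (simp only: fst_conv snd_conv)
  qed
  moreover have "isCont (fst \<circ> \<gamma>) 0"
  proof -
    have "isCont (\<lambda>t. fst (y t)) 0"
      by (rule continuous_fst[OF yc])
    moreover have "isCont (cinv c) (fst (y 0))"
      using continuous_on_cinv[OF assms(1)] open_cimg[OF assms(1)] assms(2) y(2)
      by (simp add: continuous_on_eq_continuous_at)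
    ultimately have "isCont (\<lambda>t. cinv c (fst (y t))) 0"
      by (rule isCont_o2)
    moreover have "eventually (\<lambda>t. (fst \<circ> \<gamma>) t = cinv c (fst (y t))) (nhds 0)"
      using ev by (rule eventually_mono) (simp add: fst_chart_point)
    ultimately show ?thesis
      using isCont_cong[of "fst \<circ> \<gamma>" "\<lambda>t. cinv c (fst (y t))" 0] by simp
  qed
  moreover have "\<gamma> t \<in> twistors" for t
    using chart_point_in[OF assms(1)] assms(2,3) by (cases "y t") (simp add: \<gamma>_def bundle_chart_image_def)
  moreover have "\<gamma> 0 = chart_point c z w"
    by (simp add: \<gamma>_def y)
  ultimately have "has_velocity A twistors \<gamma> (chart_point c z w) (coord_ttvec c z w v \<eta>)"
    by (auto simp: has_velocity_def fst_chart_point coord_ttvec_def)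
  then show ?thesis
    by blast
qed

lemma tw_tangent_chart_point:
  assumes "c \<in> A" "z \<in> cimg c" "norm w < 1"
  shows "\<xi> \<in> tw_tangent A twistors (chart_point c z w) \<longleftrightarrow> (\<exists>v \<eta>. \<xi> = coord_ttvec c z w v \<eta>)"
  using velocity_coords[OF assms] coord_ttvec_is_velocity[OF assms] unfolding tw_tangent_def mem_Collect_eq
  by metis

lemma tw_differential_coord_ttvec:
  assumes "c \<in> A" "z \<in> cimg c" "norm w < 1"
    and f: "((\<lambda>y. f (chart_point c (fst y) (snd y))) has_derivative D) (at (z, w))"
  shows "tw_differential A twistors f (chart_point c z w) (coord_ttvec c z w v \<eta>) = D (v, \<eta>)"
proof -
  have *: "((f \<circ> \<gamma>) has_vector_derivative D (v, \<eta>)) (at 0)"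
    if vel: "has_velocity A twistors \<gamma> (chart_point c z w) (coord_ttvec c z w v \<eta>)" for \<gamma>
  proof -
    obtain y v' \<eta>' where y: "(y has_vector_derivative (v', \<eta>')) (at 0)" "y 0 = (z, w)"
      "eventually (\<lambda>t. \<gamma> t = chart_point c (fst (y t)) (snd (y t))) (nhds 0)"
      "coord_ttvec c z w v \<eta> = coord_ttvec c z w v' \<eta>'"
      using velocity_coords[OF assms(1-3) vel] by blast
    have "(v, \<eta>) = (v', \<eta>')"
      using coord_ttvec_inj[OF assms(1-3)] y(4) by metis
    moreover have "((f \<circ> \<gamma>) has_vector_derivative D (v', \<eta>')) (at 0)"
      by (rule chain_along_curve[OF y(1,2) f]) (use y(3) in \<open>auto elim: eventually_mono\<close>)
    ultimately show ?thesis
      by simp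
  qed
  show ?thesis
    unfolding tw_differential_def
    using coord_ttvec_is_velocity[OF assms(1-3)] * vector_derivative_unique_at by (intro the_equality) blast+
qed

end

section \<open>The almost complex structure in the chart\<close>

lemma djPQ_inj:
  assumes "norm w < 1" "djP w \<eta> = djP w \<eta>'" "djQ w \<eta> = djQ w \<eta>'"
  shows "\<eta> = \<eta>'"
  using assms disc_weight_nonzero[OF assms(1)] by (auto simp: djP_def djQ_def)

text \<open>Composition with \<open>j\<close> on vertical vectors is multiplication by \<open>\<i>\<close> in the fibre coordinate: \<open>w\<close> is a
  holomorphic coordinate of the fibre. This is why the first equation of the theorem is
  the ordinary Cauchy-Riemann equation in \<open>w\<close>.\<close>

lemma djPQ_times_i:
  assumes "norm w < 1"
  shows "rlin (jP w) (jQ w) (rlin (djP w \<eta>) (djQ w \<eta>) a) = rlin (djP w (\<i> * \<eta>)) (djQ w (\<i> * \<eta>)) a"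
proof -
  define s where "s = disc_weight w"
  define \<sigma> where "\<sigma> = w * cnj \<eta> + \<eta> * cnj w"
  have e: "w * cnj w * s = s - 1"
    using disc_weight_eq[OF assms] by (simp add: s_def)
  have P: "jP w = \<i> * (2 * s - 1)" and Q: "jQ w = - 2 * \<i> * w * s"
    and cs: "cnj s = s" "cnj \<sigma> = \<sigma>"
    and dP: "djP w \<eta> = 2 * \<i> * s\<^sup>2 * \<sigma>" and dQ: "djQ w \<eta> = - 2 * \<i> * (\<eta> * s + w * s\<^sup>2 * \<sigma>)"
    and dP': "djP w (\<i> * \<eta>) = 2 * s\<^sup>2 * (w * cnj \<eta> - \<eta> * cnj w)"
    and dQ': "djQ w (\<i> * \<eta>) = 2 * (\<eta> * s + w * s\<^sup>2 * (\<eta> * cnj w - w * cnj \<eta>))"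
    by (simp_all add: jP_def jQ_def djP_def djQ_def d_disc_weight_def s_def \<sigma>_def algebra_simps)
  have 1: "jP w * djP w \<eta> + jQ w * cnj (djQ w \<eta>) = djP w (\<i> * \<eta>)"
  proof -
    have "jP w * djP w \<eta> + jQ w * cnj (djQ w \<eta>)
        = s\<^sup>2 * (\<sigma> * (2 - 4 * (s - w * cnj w * s)) + 4 * w * cnj \<eta>)"
      unfolding P Q dP dQ by (simp add: cs algebra_simps power2_eq_square)
    also have "\<dots> = djP w (\<i> * \<eta>)"
      unfolding e dP' by (simp add: \<sigma>_def algebra_simps)
    finally show ?thesis .
  qed
  have 2: "jP w * djQ w \<eta> + jQ w * cnj (djP w \<eta>) = djQ w (\<i> * \<eta>)"
  proof -
    have "jP w * djQ w \<eta> + jQ w * cnj (djP w \<eta>) - djQ w (\<i> * \<eta>)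
        = 4 * s * \<eta> * (s - 1 - w * cnj w * s)"
      unfolding P Q dP dQ dQ' by (simp add: cs \<sigma>_def algebra_simps power2_eq_square)
    then show ?thesis
      unfolding e by simp
  qed
  show ?thesis
    unfolding 1[symmetric] 2[symmetric] by (simp add: rlin_def algebra_simps)
qed

text \<open>The derivative of the fibre coordinate along the horizontal lift of \<open>v\<close>, where \<open>\<Gamma>\<close> is the Christoffel
  symbol. The imaginary number \<open>\<Gamma> v - cnj (\<Gamma> v)\<close> expresses that parallel transport rotates \<open>w\<close>.\<close>

definition horizontal_rate :: "complex \<Rightarrow> complex \<Rightarrow> complex \<Rightarrow> complex" where
  "horizontal_rate \<Gamma> w v = - (\<Gamma> * v - cnj (\<Gamma> * v)) * w"

text \<open>The two expressions on the left are the parts of the covariant derivative of the canonical section.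
  The connection form contributes the commutator of multiplication by
  \<open>\<Gamma> v\<close> with \<open>j\<close>, which is purely antilinear.\<close>

lemma horizontal_rate_iff:
  assumes "norm w < 1"
  shows "djP w \<eta> = 0 \<and> djQ w \<eta> + jQ w * (\<Gamma> * v - cnj (\<Gamma> * v)) = 0 \<longleftrightarrow> \<eta> = horizontal_rate \<Gamma> w v"
proof
  assume *: "djP w \<eta> = 0 \<and> djQ w \<eta> + jQ w * (\<Gamma> * v - cnj (\<Gamma> * v)) = 0"
  then have "d_disc_weight w \<eta> = 0"
    by (simp add: djP_def)
  with * have "- 2 * \<i> * disc_weight w * (\<eta> + w * (\<Gamma> * v - cnj (\<Gamma> * v))) = 0"
    by (simp only: djQ_def jQ_def) (simp add: algebra_simps)
  then have "\<eta> + w * (\<Gamma> * v - cnj (\<Gamma> * v)) = 0"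
    using disc_weight_nonzero[OF assms] by simp
  then have "\<eta> = - (w * (\<Gamma> * v - cnj (\<Gamma> * v)))"
    by (simp only: eq_neg_iff_add_eq_0)
  then show "\<eta> = horizontal_rate \<Gamma> w v"
    by (simp add: horizontal_rate_def algebra_simps)
next
  assume \<eta>: "\<eta> = horizontal_rate \<Gamma> w v"
  have "d_disc_weight w \<eta> = 0"
    by (simp add: d_disc_weight_def \<eta> horizontal_rate_def algebra_simps)
  then show "djP w \<eta> = 0 \<and> djQ w \<eta> + jQ w * (\<Gamma> * v - cnj (\<Gamma> * v)) = 0"
    by (simp add: djP_def djQ_def jQ_def \<eta> horizontal_rate_def algebra_simps)
qed

text \<open>The linear algebra behind the theorem. The left-hand side says that the differential \<open>D\<close> is complex linear
  for the almost complex structure. On vertical vectors this means \<open>fwb = 0\<close>. On horizontal lifts \<open>D\<close> is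
  a real linear form \<open>\<alpha> v + \<beta> cnj v\<close>, and it is complex linear for \<open>j\<close> iff it vanishes on
  the eigenvector \<open>\<partial>\<^bsub>cnj z\<^esub> + w \<partial>\<^sub>z\<close> of \<open>j\<close> for \<open>-\<i>\<close>, which means \<open>\<beta> + w \<alpha> = 0\<close>. This
  equation, multiplied by \<open>h\<close>, is the second conjunct on the right.\<close>

lemma CR_equations_iff:
  fixes h \<Gamma> w :: complex
  assumes w: "norm w < 1" and h: "h \<noteq> 0" "cnj h = h"
    and D: "\<And>v \<eta>. D (v, \<eta>) = fz * v + fzb * cnj v + fw * \<eta> + fwb * cnj \<eta>"
  shows "(\<forall>v \<eta>. D (rlin (jP w) (jQ w) v,
        horizontal_rate (hz / h) w (rlin (jP w) (jQ w) v) + \<i> * (\<eta> - horizontal_rate (hz / h) w v)) = \<i> * D (v, \<eta>))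
    \<longleftrightarrow> fwb = 0 \<and> h * fzb + h * w * fz + w * (cnj hz - w * hz) * fw = 0"
    (is "(\<forall>v \<eta>. ?E v \<eta>) \<longleftrightarrow> ?R")
proof -
  define \<alpha> \<beta> where "\<alpha> = fz - fw * w * (hz / h)" and "\<beta> = fzb + fw * w * cnj (hz / h)"
  have hor_part: "D (v, horizontal_rate (hz / h) w v) = rlin \<alpha> \<beta> v" if "fwb = 0" for v
    by (simp add: D that horizontal_rate_def \<alpha>_def \<beta>_def rlin_def algebra_simps)
  have compose: "rlin \<alpha> \<beta> (rlin (jP w) (jQ w) v) - \<i> * rlin \<alpha> \<beta> v
      = rlin (2 * \<i> * disc_weight w * cnj w * (\<beta> + w * \<alpha>)) (- 2 * \<i> * disc_weight w * (\<beta> + w * \<alpha>)) v" for v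
  proof -
    have "rlin \<alpha> \<beta> (rlin (jP w) (jQ w) v) - \<i> * rlin \<alpha> \<beta> v
      = rlin (2 * \<i> * ((disc_weight w - 1) * \<alpha> + \<beta> * cnj w * disc_weight w))
          (- 2 * \<i> * disc_weight w * (\<beta> + w * \<alpha>)) v"
      by (simp add: rlin_def jP_def jQ_def algebra_simps)
    then show ?thesis
      unfolding disc_weight_eq[OF w, symmetric] by (simp add: algebra_simps)
  qed
  have R: "?R \<longleftrightarrow> fwb = 0 \<and> \<beta> + w * \<alpha> = 0"
  proof -
    have "h * (\<beta> + w * \<alpha>) = h * fzb + h * w * fz + w * (cnj hz - w * hz) * fw"
      using h by (simp add: \<alpha>_def \<beta>_def field_simps)
    then show ?thesis
      using h(1) by (metis mult_eq_0_iff)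
  qed
  have E: "?E v \<eta> \<longleftrightarrow> rlin \<alpha> \<beta> (rlin (jP w) (jQ w) v) = \<i> * rlin \<alpha> \<beta> v" if "fwb = 0" for v \<eta>
  proof -
    have *: "D (v', horizontal_rate (hz / h) w v' + \<eta>') = rlin \<alpha> \<beta> v' + fw * \<eta>'" for v' \<eta>'
      using hor_part[OF that, of v'] by (simp add: D that algebra_simps)
    have D\<eta>: "D (v, \<eta>) = rlin \<alpha> \<beta> v + fw * (\<eta> - horizontal_rate (hz / h) w v)"
      using *[of v "\<eta> - horizontal_rate (hz / h) w v"] by simp
    show ?thesis
      unfolding * D\<eta> by (simp add: algebra_simps)
  qed
  show ?thesis
    unfolding R
  proof (intro iffI conjI allI)
    assume all: "\<forall>v \<eta>. ?E v \<eta>"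
    \<comment> \<open>The vertical vector \<open>(0, 1)\<close> isolates \<open>fwb\<close>.\<close>
    from all have "?E 0 1"
      by blast
    then have "fw * \<i> + fwb * cnj \<i> = \<i> * (fw + fwb)"
      by (simp add: D rlin_def horizontal_rate_def)
    then show fwb: "fwb = 0"
      by (simp add: algebra_simps)
    have "rlin (2 * \<i> * disc_weight w * cnj w * (\<beta> + w * \<alpha>)) (- 2 * \<i> * disc_weight w * (\<beta> + w * \<alpha>)) v
        = rlin 0 0 v" for v
      unfolding compose[symmetric] using all E[OF fwb] by (simp add: rlin_def)
    from rlin_eqD(2)[OF this] show "\<beta> + w * \<alpha> = 0"
      using disc_weight_nonzero[OF w] by simp
  next
    fix v \<eta> assume r: "fwb = 0 \<and> \<beta> + w * \<alpha> = 0"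
    then have "rlin \<alpha> \<beta> (rlin (jP w) (jQ w) v) - \<i> * rlin \<alpha> \<beta> v = 0"
      unfolding compose by (simp add: rlin_def)
    then show "?E v \<eta>"
      unfolding E[OF conjunct1[OF r]] by simp
  qed
qed

context conformal_surface
begin

lemma d_pi_coord_ttvec:
  assumes "c \<in> A" "z \<in> cimg c"
  shows "d_pi (coord_ttvec c z w v \<eta>) = coord_vec A c v (cinv c z)"
  using assms by (auto simp: fun_eq_iff d_pi_def coord_ttvec_def coord_vec_def coord_cinv)

lemma coord_ttvec_vertical_iff:
  assumes "c \<in> A" "z \<in> cimg c" "norm w < 1"
  shows "coord_ttvec c z w v \<eta> \<in> vertical A twistors (chart_point c z w) \<longleftrightarrow> v = 0"
proof -
  have "coord_vec A c v (cinv c z) = 0\<^sub>t \<longleftrightarrow> v = 0"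
    using coord_vec_self[OF assms(1) cinv_in_cdom[OF assms(1,2)], of v] coord_vec_zero[of c] by metis
  moreover have "coord_ttvec c z w v \<eta> \<in> tw_tangent A twistors (chart_point c z w)"
    using tw_tangent_chart_point[OF assms] by blast
  ultimately show ?thesis
    by (simp add: vertical_def d_pi_coord_ttvec[OF assms(1,2)])
qed

lemma vert_endo_coord_ttvec:
  assumes "c \<in> A" "z \<in> cimg c" "u \<in> tangent_space A (cinv c z)"
  shows "vert_endo (coord_ttvec c z w 0 \<eta>) u
    = coord_vec A c (rlin (djP w \<eta>) (djQ w \<eta>) (u c)) (cinv c z)"
proof
  fix d
  define x where "x = cinv c z"
  have x: "x \<in> cdom c" "z = coord c x"
    using assms by (simp_all add: x_def cinv_in_cdom coord_cinv)
  show "vert_endo (coord_ttvec c z w 0 \<eta>) u d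
      = coord_vec A c (rlin (djP w \<eta>) (djQ w \<eta>) (u c)) (cinv c z) d"
  proof (cases "d \<in> charts_at A x")
    case True
    then have d: "d \<in> A" "x \<in> cdom d"
      by (simp_all add: charts_at_def)
    have s: "jac c d z \<noteq> 0"
      using jac_nonzero[OF assms(1) d(1) x(1) d(2)] x(2) by simp
    have comp: "coord_vec A c b x d = jac c d z * b" for b
      using coord_vec_comp[OF d] by (simp only: x(2)[symmetric])
    have "coord_vec A c (u c) x = u"
      using coord_vec_of_comp[OF assms(1) x(1)] assms(3) unfolding x_def .
    then have ud: "u d = jac c d z * u c"
      using comp[of "u c"] by simp
    have "vert_endo (coord_ttvec c z w 0 \<eta>) u d
        = rlin (djP w \<eta>) (jac c d z / cnj (jac c d z) * djQ w \<eta>) (u d)"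
      using True by (simp add: vert_endo_def coord_ttvec_def x_def[symmetric] rblin_apply)
    also have "\<dots> = jac c d z * rlin (djP w \<eta>) (djQ w \<eta>) (u c)"
      using s by (simp add: rlin_def ud algebra_simps)
    finally show ?thesis
      by (simp only: comp x_def[symmetric])
  qed (simp add: vert_endo_def coord_ttvec_def coord_vec_def x_def)
qed

text \<open>A vertical vector is mapped to a vertical one, so the image has the form \<open>coord_ttvec c z w 0 \<eta>'\<close>,
  and \<open>\<eta>'\<close> can be read off from the endomorphism.\<close>

lemma J_vertical:
  assumes "c \<in> A" "z \<in> cimg c" "norm w < 1"
    and J: "is_J_nabla A nabla twistors (chart_point c z w) J"
  shows "J (coord_ttvec c z w 0 \<eta>) = coord_ttvec c z w 0 (\<i> * \<eta>)"
proof -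
  define x where "x = cinv c z"
  have x: "x \<in> cdom c"
    using assms cinv_in_cdom x_def by blast
  let ?\<xi> = "coord_ttvec c z w 0 \<eta>"
  have "?\<xi> \<in> vertical A twistors (chart_point c z w)"
    using coord_ttvec_vertical_iff[OF assms(1-3)] by blast
  then have v: "J ?\<xi> \<in> vertical A twistors (chart_point c z w)"
    and e: "\<And>u. u \<in> tangent_space A x \<Longrightarrow>
      vert_endo (J ?\<xi>) u = snd (chart_point c z w) (vert_endo ?\<xi> u)"
    using J unfolding is_J_nabla_def fst_chart_point x_def by blast+
  from v have "J ?\<xi> \<in> tw_tangent A twistors (chart_point c z w)"
    by (simp add: vertical_def)
  then obtain v' \<eta>' where "J ?\<xi> = coord_ttvec c z w v' \<eta>'"
    using tw_tangent_chart_point[OF assms(1-3)] by blast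
  with v have J\<xi>: "J ?\<xi> = coord_ttvec c z w 0 \<eta>'"
    using coord_ttvec_vertical_iff[OF assms(1-3)] by metis
  have "rlin (djP w \<eta>') (djQ w \<eta>') a = rlin (djP w (\<i> * \<eta>)) (djQ w (\<i> * \<eta>)) a" for a
  proof -
    define u where "u = coord_vec A c a x"
    have u: "u \<in> tangent_space A x" "u c = a"
      using coord_vec_in[OF assms(1) x] coord_vec_self[OF assms(1) x] by (simp_all add: u_def)
    have comp: "vert_endo (coord_ttvec c z w 0 \<zeta>) u = coord_vec A c (rlin (djP w \<zeta>) (djQ w \<zeta>) a) x" for \<zeta>
      using vert_endo_coord_ttvec[OF assms(1,2)] u by (simp add: x_def)
    have "snd (chart_point c z w) (vert_endo ?\<xi> u)
        = coord_vec A c (rlin (jP w) (jQ w) (rlin (djP w \<eta>) (djQ w \<eta>) a)) x"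
      using snd_chart_point[of "vert_endo ?\<xi> u" c z w] coord_vec_in[OF assms(1) x]
      by (simp add: comp coord_vec_self[OF assms(1) x] x_def[symmetric])
    then have "coord_vec A c (rlin (djP w \<eta>') (djQ w \<eta>') a) x
        = coord_vec A c (rlin (djP w (\<i> * \<eta>)) (djQ w (\<i> * \<eta>)) a) x"
      using e[OF u(1)] unfolding J\<xi> comp djPQ_times_i[OF assms(3)] by simp
    then show ?thesis
      using coord_vec_self[OF assms(1) x] by metis
  qed
  from rlin_eqD[OF this] have "\<eta>' = \<i> * \<eta>"
    by (rule djPQ_inj[OF assms(3)])
  with J\<xi> show ?thesis
    by simp
qed

end

context levi_civita_surface
begin

text \<open>The transformation law of the Christoffel symbol cancels the term in \<open>coord_ttvec\<close> that contains the second derivative of the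
  transition map. Hence the covariant derivative of the canonical section is a tensor: its antilinear part
  in the chart \<open>d\<close> is the one in \<open>c\<close> times \<open>jac c d z / cnj (jac c d z)\<close>, as for every endomorphism.\<close>

lemma nabla_Phi_coord_ttvec:
  assumes "c \<in> A" "z \<in> cimg c" "norm w < 1"
    and d: "d \<in> charts_at A (cinv c z)" and u: "u \<in> tangent_space A (cinv c z)"
  shows "nabla_Phi A nabla (chart_point c z w) (coord_ttvec c z w v \<eta>) u d
    = rlin (djP w \<eta>) (jac c d z / cnj (jac c d z)
        * (djQ w \<eta> + jQ w * (christoffel c z * v - cnj (christoffel c z * v)))) (u d)"
proof -
  define x where "x = cinv c z"
  define s k G where "s = jac c d z" and "k = deriv (jac c d) z" and "G = christoffel d (transition c d z)"
  define j where "j = snd (chart_point c z w)"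
  define V where "V = coord_vec A c v x"
  have x: "x \<in> cdom c" "x \<in> cdom d" "d \<in> A"
    using assms by (auto simp: x_def cinv_in_cdom charts_at_def)
  have zx: "z = coord c x" "transition c d z = coord d x"
    using assms by (simp_all add: x_def coord_cinv transition_def)
  have z: "z \<in> overlap c d"
    using x zx by blast
  have s: "s \<noteq> 0"
    using jac_nonzero[OF assms(1) x(3,1,2)] by (simp add: s_def zx)
  have V: "V \<in> tangent_space A x" "V d = s * v"
    using coord_vec_in[OF assms(1) x(1)] coord_vec_comp[OF x(3,2)]
    by (simp_all add: V_def s_def zx(1))
  have jd: "j (coord_vec A d a x) d = rlin (jP w) (s / cnj s * jQ w) a" for a
    using snd_chart_point_other_chart[OF assms(1) x(3) z] by (simp add: j_def s_def x_def)
  have jT: "j y d = rlin (jP w) (s / cnj s * jQ w) (y d)" if "y \<in> tangent_space A x" for y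
    using jd[of "y d"] coord_vec_of_comp[OF x(3,2) that] by simp
  have N: "nabla x V (coord_vec A d b) d = G * (s * v) * b" for b
    using nabla_coord_vec[OF x(3,2) V(1), of b] by (simp add: V(2) G_def zx(2))
  have "nabla_Phi A nabla (chart_point c z w) (coord_ttvec c z w v \<eta>) u d
      = rlin (djP w \<eta>) (s / cnj s * (djQ w \<eta> + jQ w * (k / s * v - cnj (k / s * v)))) (u d)
        + G * (s * v) * rlin (jP w) (s / cnj s * jQ w) (u d)
        - rlin (jP w) (s / cnj s * jQ w) (G * (s * v) * u d)"
    using d u nabla_in[OF x(3,2) V(1)] N jT
    by (simp add: nabla_Phi_def fst_chart_point d_pi_coord_ttvec[OF assms(1,2)] V_def[symmetric]
        x_def[symmetric] j_def[symmetric])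
       (simp add: coord_ttvec_def x_def[symmetric] rblin_apply s_def k_def)
  also have "\<dots> = rlin (djP w \<eta>) (s / cnj s * (djQ w \<eta>
      + jQ w * ((G * s + k / s) * v - cnj ((G * s + k / s) * v)))) (u d)"
    by (simp add: rlin_def algebra_simps)
  also have "G * s + k / s = christoffel c z"
    using christoffel_change[OF assms(1) x(3) z] by (simp add: G_def s_def k_def)
  finally show ?thesis
    by (simp add: s_def)
qed

lemma coord_ttvec_horizontal_iff:
  assumes "c \<in> A" "z \<in> cimg c" "norm w < 1"
  shows "coord_ttvec c z w v \<eta> \<in> horizontal A nabla twistors (chart_point c z w) \<longleftrightarrow> \<eta> = horizontal_rate (christoffel c z) w v"
proof -
  define x where "x = cinv c z"
  have x: "x \<in> cdom c"
    using assms cinv_in_cdom x_def by blast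
  have cx: "c \<in> charts_at A x"
    using assms(1) x by (simp add: charts_at_def)
  define q where "q = djQ w \<eta> + jQ w * (christoffel c z * v - cnj (christoffel c z * v))"
  have Phi: "nabla_Phi A nabla (chart_point c z w) (coord_ttvec c z w v \<eta>) u d
      = rlin (djP w \<eta>) (jac c d z / cnj (jac c d z) * q) (u d)"
    if "u \<in> tangent_space A x" "d \<in> charts_at A x" for u d
    using nabla_Phi_coord_ttvec[OF assms, of d u] that by (simp add: x_def q_def)
  have "coord_ttvec c z w v \<eta> \<in> horizontal A nabla twistors (chart_point c z w) \<longleftrightarrow>
      (\<forall>u\<in>tangent_space A x. nabla_Phi A nabla (chart_point c z w) (coord_ttvec c z w v \<eta>) u = 0\<^sub>t)"
    using tw_tangent_chart_point[OF assms] by (auto simp: horizontal_def fst_chart_point x_def)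
  also have "\<dots> \<longleftrightarrow> djP w \<eta> = 0 \<and> q = 0"
  proof
    assume *: "\<forall>u\<in>tangent_space A x. nabla_Phi A nabla (chart_point c z w) (coord_ttvec c z w v \<eta>) u = 0\<^sub>t"
    have "rlin (djP w \<eta>) q a = rlin 0 0 a" for a
    proof -
      have "nabla_Phi A nabla (chart_point c z w) (coord_ttvec c z w v \<eta>) (coord_vec A c a x) c = 0"
        using * coord_vec_in[OF assms(1) x] by simp
      then show ?thesis
        using Phi[OF coord_vec_in[OF assms(1) x] cx]
        by (simp add: jac_refl assms(1,2) coord_vec_self[OF assms(1) x] rlin_def)
    qed
    from rlin_eqD[OF this] show "djP w \<eta> = 0 \<and> q = 0"
      by simp
  next
    assume *: "djP w \<eta> = 0 \<and> q = 0"
    show "\<forall>u\<in>tangent_space A x. nabla_Phi A nabla (chart_point c z w) (coord_ttvec c z w v \<eta>) u = 0\<^sub>t"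
    proof (intro ballI ext)
      fix u d assume "u \<in> tangent_space A x"
      then show "nabla_Phi A nabla (chart_point c z w) (coord_ttvec c z w v \<eta>) u d = 0"
        using Phi[of u d] * by (cases "d \<in> charts_at A x")
          (simp_all add: rlin_def nabla_Phi_def fst_chart_point x_def)
    qed
  qed
  also have "\<dots> \<longleftrightarrow> \<eta> = horizontal_rate (christoffel c z) w v"
    unfolding q_def by (rule horizontal_rate_iff[OF assms(3)])
  finally show ?thesis .
qed

lemma J_horizontal:
  assumes "c \<in> A" "z \<in> cimg c" "norm w < 1"
    and J: "is_J_nabla A nabla twistors (chart_point c z w) J"
  shows "J (coord_ttvec c z w v (horizontal_rate (christoffel c z) w v))
    = coord_ttvec c z w (rlin (jP w) (jQ w) v) (horizontal_rate (christoffel c z) w (rlin (jP w) (jQ w) v))"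
proof -
  define x where "x = cinv c z"
  have x: "x \<in> cdom c"
    using assms cinv_in_cdom x_def by blast
  let ?\<xi> = "coord_ttvec c z w v (horizontal_rate (christoffel c z) w v)"
  have "?\<xi> \<in> horizontal A nabla twistors (chart_point c z w)"
    using coord_ttvec_horizontal_iff[OF assms(1-3)] by blast
  then have h: "J ?\<xi> \<in> horizontal A nabla twistors (chart_point c z w)"
    and e: "d_pi (J ?\<xi>) = snd (chart_point c z w) (d_pi ?\<xi>)"
    using J unfolding is_J_nabla_def by blast+
  from h have "J ?\<xi> \<in> tw_tangent A twistors (chart_point c z w)"
    by (simp add: horizontal_def)
  then obtain v' \<eta>' where J\<xi>: "J ?\<xi> = coord_ttvec c z w v' \<eta>'"
    using tw_tangent_chart_point[OF assms(1-3)] by blast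
  have \<eta>': "\<eta>' = horizontal_rate (christoffel c z) w v'"
    using h coord_ttvec_horizontal_iff[OF assms(1-3)] unfolding J\<xi> by blast
  have "coord_vec A c v' x = snd (chart_point c z w) (coord_vec A c v x)"
    using e unfolding J\<xi> d_pi_coord_ttvec[OF assms(1,2)] x_def .
  also have "\<dots> = coord_vec A c (rlin (jP w) (jQ w) v) x"
    using snd_chart_point[of "coord_vec A c v x" c z w] coord_vec_in[OF assms(1) x]
      coord_vec_self[OF assms(1) x] by (simp add: x_def)
  finally have "v' = rlin (jP w) (jQ w) v"
    using coord_vec_self[OF assms(1) x] by metis
  with J\<xi> \<eta>' show ?thesis
    by simp
qed

text \<open>The horizontal lift of \<open>v\<close> is split off, the vertical remainder is multiplied by \<open>\<i>\<close>, and the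
  horizontal part becomes the lift of \<open>j v\<close>.\<close>

lemma J_coord_ttvec:
  assumes "c \<in> A" "z \<in> cimg c" "norm w < 1"
    and J: "is_J_nabla A nabla twistors (chart_point c z w) J"
  shows "J (coord_ttvec c z w v \<eta>) = coord_ttvec c z w (rlin (jP w) (jQ w) v)
     (horizontal_rate (christoffel c z) w (rlin (jP w) (jQ w) v) + \<i> * (\<eta> - horizontal_rate (christoffel c z) w v))"
proof -
  let ?h = "horizontal_rate (christoffel c z) w"
  have split: "coord_ttvec c z w v \<eta> = coord_ttvec c z w v (?h v) +\<^sub>t coord_ttvec c z w 0 (\<eta> - ?h v)"
    unfolding coord_ttvec_add by simp
  have "J (coord_ttvec c z w v (?h v) +\<^sub>t coord_ttvec c z w 0 (\<eta> - ?h v))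
      = J (coord_ttvec c z w v (?h v)) +\<^sub>t J (coord_ttvec c z w 0 (\<eta> - ?h v))"
    using J tw_tangent_chart_point[OF assms(1-3)] unfolding is_J_nabla_def fam_linear_on_def by blast
  then show ?thesis
    unfolding split J_horizontal[OF assms] J_vertical[OF assms] coord_ttvec_add by simp
qed

section \<open>The Cauchy-Riemann equations\<close>

text \<open>The theorem at a single point. The Wirtinger derivatives of the two partial functions are the
  coefficients of the derivative of \<open>f\<close> in the chart, which turns complex linearity of the differential into
  a statement of linear algebra.\<close>

lemma holomorphic_at_iff:
  fixes f :: "'a tpoint \<Rightarrow> complex" and c :: "'a chart"
  defines "F \<equiv> \<lambda>z w. f (twistor_point A (kaehler_form g) c z w)"
    and "h \<equiv> \<lambda>z. complex_of_real (factor c z)"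
  assumes c: "c \<in> A" and z: "z \<in> cimg c" and w: "norm w < 1"
    and J: "is_J_nabla A nabla twistors (chart_point c z w) J"
    and diff: "(\<lambda>(z, w). F z w) differentiable (at (z, w))"
  shows "(\<forall>\<xi>\<in>tw_tangent A twistors (chart_point c z w). tw_differential A twistors f (chart_point c z w) (J \<xi>)
      = \<i> * tw_differential A twistors f (chart_point c z w) \<xi>) \<longleftrightarrow>
    wirtinger_bar (F z) w = 0 \<and>
    h z * wirtinger_bar (\<lambda>z'. F z' w) z + h z * w * wirtinger (\<lambda>z'. F z' w) z
      + w * (wirtinger_bar h z - w * wirtinger h z) * wirtinger (F z) w = 0"
proof -
  note [simp] = twistor_point_eq[OF c]
  obtain D where D: "((\<lambda>(z, w). F z w) has_derivative D) (at (z, w))"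
    using diff by (auto simp: differentiable_def)
  have Dm: "((\<lambda>y. f (chart_point c (fst y) (snd y))) has_derivative D) (at (z, w))"
    by (rule has_derivative_transform_within_open[OF D open_bundle_chart_image[OF c]])
       (use z w in \<open>auto simp: bundle_chart_image_def F_def\<close>)
  have "((\<lambda>w'. (z, w')) has_derivative (\<lambda>\<eta>. (0, \<eta>))) (at w)"
    by (auto intro!: derivative_eq_intros)
  from has_derivative_compose[OF this D]
  have Fw: "(F z has_derivative (\<lambda>\<eta>. D (0, \<eta>))) (at w)"
    by simp
  have "((\<lambda>z'. (z', w)) has_derivative (\<lambda>v. (v, 0))) (at z)"
    by (auto intro!: derivative_eq_intros)
  from has_derivative_compose[OF this D]
  have Fz: "((\<lambda>z'. F z' w) has_derivative (\<lambda>v. D (v, 0))) (at z)"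
    by simp
  have D0: "D (0, \<eta>) = wirtinger (F z) w * \<eta> + wirtinger_bar (F z) w * cnj \<eta>" for \<eta>
    using frechet_derivative_wirtinger[OF differentiableI[OF Fw], of \<eta>]
    by (simp add: frechet_derivative_eqI[OF Fw])
  have D1: "D (v, 0) = wirtinger (\<lambda>z'. F z' w) z * v + wirtinger_bar (\<lambda>z'. F z' w) z * cnj v" for v
    using frechet_derivative_wirtinger[OF differentiableI[OF Fz], of v]
    by (simp add: frechet_derivative_eqI[OF Fz])
  have Dsum: "D (v, \<eta>) = wirtinger (\<lambda>z'. F z' w) z * v + wirtinger_bar (\<lambda>z'. F z' w) z * cnj v
      + wirtinger (F z) w * \<eta> + wirtinger_bar (F z) w * cnj \<eta>" for v \<eta>
    using linear_add[OF has_derivative_linear[OF D], of "(v, 0)" "(0, \<eta>)"] D0[of \<eta>] D1[of v]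
    by simp
  have h: "h z \<noteq> 0" "cnj (h z) = h z"
    using factor_pos[OF c cinv_in_cdom[OF c z]] by (simp_all add: h_def coord_cinv c z)
  have hb: "wirtinger_bar h z = cnj (wirtinger h z)"
    unfolding h_def by (rule wirtinger_bar_of_real(1)[OF factor_differentiable[OF c z]])
  have ch: "christoffel c z = wirtinger h z / h z"
    by (simp add: christoffel_def h_def)
  note df = tw_differential_coord_ttvec[OF c z w Dm]
  have "(\<forall>\<xi>\<in>tw_tangent A twistors (chart_point c z w). tw_differential A twistors f (chart_point c z w) (J \<xi>)
      = \<i> * tw_differential A twistors f (chart_point c z w) \<xi>) \<longleftrightarrow>
    (\<forall>v \<eta>. tw_differential A twistors f (chart_point c z w) (J (coord_ttvec c z w v \<eta>))
      = \<i> * tw_differential A twistors f (chart_point c z w) (coord_ttvec c z w v \<eta>))"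
    unfolding Ball_def tw_tangent_chart_point[OF c z w] by auto
  also have "\<dots> \<longleftrightarrow> wirtinger_bar (F z) w = 0 \<and>
    h z * wirtinger_bar (\<lambda>z'. F z' w) z + h z * w * wirtinger (\<lambda>z'. F z' w) z
      + w * (wirtinger_bar h z - w * wirtinger h z) * wirtinger (F z) w = 0"
    unfolding J_coord_ttvec[OF c z w J] df ch hb by (rule CR_equations_iff[OF w h Dsum])
  finally show ?thesis .
qed

end

theorem proposition7:
  fixes A :: "'a::t2_space chart set"
    and g :: "'a \<Rightarrow> 'a tvec \<Rightarrow> 'a tvec \<Rightarrow> real"
    and nabla :: "'a connection"
    and J :: "'a tpoint \<Rightarrow> 'a ttvec \<Rightarrow> 'a ttvec"
    and c :: "'a chart"
    and W :: "'a tpoint set"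
    and f :: "'a tpoint \<Rightarrow> complex"
  defines "Z \<equiv> twistor_space A (kaehler_form g)"
    and "h \<equiv> \<lambda>z. complex_of_real (conformal_factor A g c z)"
    and "F \<equiv> \<lambda>z w. f (twistor_point A (kaehler_form g) c z w)"
  assumes "riemann_surface A" and "conformal_metric A g" and "levi_civita A g nabla"
    and "\<forall>p\<in>Z. is_J_nabla A nabla Z p (J p)"
    and "c \<in> A"
    and "twistor_open A (kaehler_form g) W" and "\<forall>p\<in>W. fst p \<in> cdom c"
    and "twistor_smooth A (kaehler_form g) W f"
  shows "J_holomorphic A Z J W f \<longleftrightarrow>
    (\<forall>z\<in>cimg c. \<forall>w. norm w < 1 \<and> twistor_point A (kaehler_form g) c z w \<in> W \<longrightarrow>
       wirtinger_bar (F z) w = 0 \<and>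
       h z * wirtinger_bar (\<lambda>z'. F z' w) z + h z * w * wirtinger (\<lambda>z'. F z' w) z
         + w * (wirtinger_bar h z - w * wirtinger h z) * wirtinger (F z) w = 0)"
proof -
  interpret levi_civita_surface A g nabla
    by unfold_locales (fact assms)+
  note [simp] = twistor_point_eq[OF \<open>c \<in> A\<close>]
  have WZ: "W \<subseteq> Z"
    using assms by (simp add: twistor_open_def)
  have W: "\<exists>z\<in>cimg c. \<exists>w. norm w < 1 \<and> p = chart_point c z w" if "p \<in> W" for p
  proof -
    have p: "p \<in> Z" "fst p \<in> cdom c"
      using WZ assms that by auto
    then show ?thesis
      using chart_point_surj[OF \<open>c \<in> A\<close> p[unfolded Z_def]] coord_in_cimg[OF \<open>c \<in> A\<close> p(2)] by metis
  qed
  have over_W: "(\<forall>p\<in>W. P p) \<longleftrightarrow>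
      (\<forall>z\<in>cimg c. \<forall>w. norm w < 1 \<and> chart_point c z w \<in> W \<longrightarrow> P (chart_point c z w))" for P
    using W by metis
  have diff: "(\<lambda>(z, w). F z w) differentiable (at (z, w))"
    if "z \<in> cimg c" "norm w < 1" "chart_point c z w \<in> W" for z w
    unfolding F_def
    by (rule Cinf_on_imp_differentiable) (use assms that in \<open>auto simp: twistor_smooth_def\<close>)
  have "J_holomorphic A Z J W f \<longleftrightarrow> (\<forall>z\<in>cimg c. \<forall>w. norm w < 1 \<and> chart_point c z w \<in> W \<longrightarrow>
      (\<forall>\<xi>\<in>tw_tangent A Z (chart_point c z w). tw_differential A Z f (chart_point c z w) (J (chart_point c z w) \<xi>)
        = \<i> * tw_differential A Z f (chart_point c z w) \<xi>))"
    unfolding J_holomorphic_def by (rule over_W)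
  also have "\<dots> \<longleftrightarrow> (\<forall>z\<in>cimg c. \<forall>w. norm w < 1 \<and> twistor_point A (kaehler_form g) c z w \<in> W \<longrightarrow>
       wirtinger_bar (F z) w = 0 \<and>
       h z * wirtinger_bar (\<lambda>z'. F z' w) z + h z * w * wirtinger (\<lambda>z'. F z' w) z
         + w * (wirtinger_bar h z - w * wirtinger h z) * wirtinger (F z) w = 0)"
  proof (intro ball_cong refl all_cong1 imp_cong)
    fix z w assume z: "z \<in> cimg c"
    show "norm w < 1 \<and> chart_point c z w \<in> W \<longleftrightarrow>
        norm w < 1 \<and> twistor_point A (kaehler_form g) c z w \<in> W"
      using z by auto
    assume "norm w < 1 \<and> twistor_point A (kaehler_form g) c z w \<in> W"
    then have w: "norm w < 1" "chart_point c z w \<in> W"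
      using z by auto
    have "is_J_nabla A nabla Z (chart_point c z w) (J (chart_point c z w))"
      using assms WZ w by blast
    from holomorphic_at_iff[OF \<open>c \<in> A\<close> z w(1) this[unfolded Z_def] diff[OF z w, unfolded F_def]]
    show "(\<forall>\<xi>\<in>tw_tangent A Z (chart_point c z w). tw_differential A Z f (chart_point c z w) (J (chart_point c z w) \<xi>)
        = \<i> * tw_differential A Z f (chart_point c z w) \<xi>) \<longleftrightarrow>
       wirtinger_bar (F z) w = 0 \<and>
       h z * wirtinger_bar (\<lambda>z'. F z' w) z + h z * w * wirtinger (\<lambda>z'. F z' w) z
         + w * (wirtinger_bar h z - w * wirtinger h z) * wirtinger (F z) w = 0"
      unfolding Z_def h_def F_def .
  qed
  finally show ?thesis .
qed

end
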